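(* Fix $\delta>0$. (i) For all sufficiently large $n$ and all $M\in[1:2^n]$, $r\in[1:n]$, with $\alpha=M/2^n$, one has $\overline\Lambda_n(\alpha,r)\ge[\tilde\psi_n(\alpha,r)]^+$, where $\tilde\psi_n$ is defined exactly as $\psi_n$ except that the index range $[n-\tau(n):n]$ in its first two clauses (the cases $r\le n/2-1$) is replaced by $[(\frac12+\delta)n:n]$. (ii) There exist sequences $\varepsilon_n^{(1)},\varepsilon_n^{(2)}\to0$ depending only on $\delta$, and $\varepsilon_n^{(3)},\varepsilon_n^{(4)}\to0$ not depending on $\delta$, none depending on $M,r$, such that for all $n$ and all $M,r$ with $\alpha:=M/2^n\in[\delta,\frac12]$ and $\beta:=r/n\in(0,\frac12-\delta]\cup[\frac12,1]$, $\overline\Lambda_n(\alpha,r)\ge\kappa_n(\alpha,r)$, where $\kappa_n(\alpha,r)=\binom{n-2}{r-1}(\varphi(\alpha)+\varepsilon_n^{(1)})$ for even $r\le n(\frac12-\delta)$; $\kappa_n(\alpha,r)=\binom{n-2}{r-1}(\hat\varphi(\alpha,\beta)+\varepsilon_n^{(2)})$ for odd $r\le n(\frac12-\delta)$; $\kappa_n(\alpha,r)=\binom{n-2}{r+1}(\varphi(\alpha)+\varepsilon_n^{(3)})$ for even $r\ge n/2-1$; $\kappa_n(\alpha,r)=\binom{n-2}{r}(\varphi(\alpha)+\varepsilon_n^{(4)})$ for odd $r\ge n/2-1$.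
   Context: $[a:b]$ is the set of integers in $[a,b]$; $[x]^+=\max\{x,0\}$. Krawtchouk polynomials: $K_k(x)=\sum_{j=0}^k(-1)^j\binom xj\binom{n-x}{k-j}$ (generalized binomial coefficients, $\binom xj=0$ for $j<0$); $\omega_i=\sum_{k=0}^rK_k(i)$. $\overline\Lambda_n(\alpha,r)$ is the optimal value of the linear program: maximize $-\sum_{k=1}^n[K_k(0)+K_k(1)(\frac1\alpha-1)]x_k$ over $x_1,\dots,x_n\ge0$ subject to $\sum_{k=1}^n[K_k(1)-K_k(i)]x_k\ge-(\omega_1-\omega_i)$, $i\in[2:n]$. $\tau(n)=\frac12(\frac n2+2-\sqrt{\frac n2+2})$; $F=\{\text{even }k:k\ge\frac{n+r+1}2\}\cup\{\text{odd }k:k\ge\max\{\frac{n+1}2,\frac{(n-1)r}{n-1-r}\}+\sqrt{\frac{(n+1)r}{2(n-1-r)}}\}$; $\psi_n(\alpha,r)=\max_{\text{odd }k\in[n-\tau(n):n]}\frac{n\binom{n-2}{r-1}}{2k-n}[2(\frac1\alpha-1)-\frac1\alpha\frac{n+1}{k+1}]$ for even $r\le n/2-1$; $\psi_n(\alpha,r)=\max_{k\in[n-\tau(n):n]\cap F}\frac{(n-1)\binom{n-2}{r-1}}{2k-n-1}[2(\frac1\alpha-1)-\frac1\alpha\frac nk]$ for odd $r\le n/2-1$; $\psi_n(\alpha,r)=\max_{\text{odd }k\in[\frac n2+1:n]}\frac{k\binom{n-2}{r+1}}{2k-n}[2(\frac1\alpha-1)-\frac1\alpha\frac nk]$ for even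 $r>n/2-1$; $\psi_n(\alpha,r)=\max_{\text{odd }k\in[\frac n2+1:n]}\frac{k\binom{n-2}{r}}{2k-n}[2(\frac1\alpha-1)-\frac1\alpha\frac nk]$ for odd $r>n/2-1$. $\varphi(\alpha)=\frac{2(1-\sqrt\alpha)^2}{\alpha}$ for $0\le\alpha<\frac14$, $\varphi(\alpha)=\frac1\alpha-2$ for $\frac14\le\alpha\le\frac12$; $\hat\varphi(\alpha,\beta)=\frac1{2\hat\eta-1}[2(\frac1\alpha-1)-\frac1{\alpha\hat\eta}]$ for $0\le\alpha<\frac14$, $\hat\varphi(\alpha,\beta)=\frac1\alpha-2$ for $\frac14\le\alpha\le\frac12$, with $\hat\eta=\max\{\frac1{2(1-\sqrt\alpha)},\min\{\frac{1+\beta}2,\frac\beta{1-\beta}\}\}$. *)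

theory Defs
  imports Complex_Main "HOL-Library.Extended_Real"
begin

definition krawtchouk :: "nat \<Rightarrow> nat \<Rightarrow> real \<Rightarrow> real" where
  "krawtchouk n k x = (\<Sum>j=0..k. (-1) ^ j * (x gchoose j) * ((real n - x) gchoose (k - j)))"

definition omega :: "nat \<Rightarrow> nat \<Rightarrow> nat \<Rightarrow> real" where
  "omega n r i = (\<Sum>k=0..r. krawtchouk n k (real i))"

text \<open>A point \<open>x\<close> of the linear program is a function on \<open>nat\<close>; only its values on
  \<open>{1..n}\<close> matter.\<close>

definition lp_feasible :: "nat \<Rightarrow> nat \<Rightarrow> (nat \<Rightarrow> real) set" where
  "lp_feasible n r = {x. (\<forall>k\<in>{1..n}. x k \<ge> 0) \<and>
     (\<forall>i\<in>{2..n}. (\<Sum>k=1..n. (krawtchouk n k 1 - krawtchouk n k (real i)) * x k)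
        \<ge> - (omega n r 1 - omega n r i))}"

definition lp_objective :: "nat \<Rightarrow> real \<Rightarrow> (nat \<Rightarrow> real) \<Rightarrow> real" where
  "lp_objective n \<alpha> x =
     - (\<Sum>k=1..n. (krawtchouk n k 0 + krawtchouk n k 1 * (1 / \<alpha> - 1)) * x k)"

text \<open>The optimal value is an extended real, so that it is also meaningful should the program
  be unbounded or infeasible.\<close>

definition Lambda_bar :: "nat \<Rightarrow> real \<Rightarrow> nat \<Rightarrow> ereal" where
  "Lambda_bar n \<alpha> r = (SUP x\<in>lp_feasible n r. ereal (lp_objective n \<alpha> x))"

definition F_set :: "nat \<Rightarrow> nat \<Rightarrow> nat set" where
  "F_set n r =
     {k. even k \<and> real k \<ge> (real n + real r + 1) / 2} \<union>
     {k. odd k \<and> real k \<ge> max ((real n + 1) / 2) ((real n - 1) * real r / (real n - 1 - real r))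
            + sqrt ((real n + 1) * real r / (2 * (real n - 1 - real r)))}"

text \<open>The maxima are over finite index sets that may be empty; the supremum in \<open>ereal\<close> is
  the maximum when the set is nonempty and \<open>-\<infinity>\<close> otherwise.\<close>

definition psi_tilde :: "real \<Rightarrow> nat \<Rightarrow> real \<Rightarrow> nat \<Rightarrow> ereal" where
  "psi_tilde \<delta> n \<alpha> r =
    (if real r \<le> real n / 2 - 1 then
       if even r then
         (SUP k\<in>{k. odd k \<and> (1/2 + \<delta>) * real n \<le> real k \<and> k \<le> n}.
            ereal (real n * ((real n - 2) gchoose (r - 1)) / (2 * real k - real n)
              * (2 * (1 / \<alpha> - 1) - 1 / \<alpha> * ((real n + 1) / (real k + 1)))))
       else
         (SUP k\<in>{k. (1/2 + \<delta>) * real n \<le> real k \<and> k \<le> n} \<inter> F_set n r.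
            ereal ((real n - 1) * ((real n - 2) gchoose (r - 1)) / (2 * real k - real n - 1)
              * (2 * (1 / \<alpha> - 1) - 1 / \<alpha> * (real n / real k))))
     else
       if even r then
         (SUP k\<in>{k. odd k \<and> real n / 2 + 1 \<le> real k \<and> k \<le> n}.
            ereal (real k * ((real n - 2) gchoose (r + 1)) / (2 * real k - real n)
              * (2 * (1 / \<alpha> - 1) - 1 / \<alpha> * (real n / real k))))
       else
         (SUP k\<in>{k. odd k \<and> real n / 2 + 1 \<le> real k \<and> k \<le> n}.
            ereal (real k * ((real n - 2) gchoose r) / (2 * real k - real n)
              * (2 * (1 / \<alpha> - 1) - 1 / \<alpha> * (real n / real k)))))"

text \<open>The next functions are only meaningful for \<open>0 < \<alpha> \<le> 1/2\<close> (and \<open>\<beta> < 1\<close>).\<close>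

definition phi :: "real \<Rightarrow> real" where
  "phi \<alpha> = (if \<alpha> < 1/4 then 2 * (1 - sqrt \<alpha>)\<^sup>2 / \<alpha> else 1 / \<alpha> - 2)"

definition eta_hat :: "real \<Rightarrow> real \<Rightarrow> real" where
  "eta_hat \<alpha> \<beta> = max (1 / (2 * (1 - sqrt \<alpha>))) (min ((1 + \<beta>) / 2) (\<beta> / (1 - \<beta>)))"

definition phi_hat :: "real \<Rightarrow> real \<Rightarrow> real" where
  "phi_hat \<alpha> \<beta> =
     (if \<alpha> < 1/4
      then 1 / (2 * eta_hat \<alpha> \<beta> - 1) * (2 * (1 / \<alpha> - 1) - 1 / (\<alpha> * eta_hat \<alpha> \<beta>))
      else 1 / \<alpha> - 2)"

text \<open>The clauses for \<open>r \<le> n (1/2 - \<delta>)\<close> take precedence over those for \<open>r \<ge> n/2 - 1\<close>; the two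
  conditions overlap only if \<open>n \<le> 1/\<delta>\<close>. For \<open>r/n\<close> in \<open>(0, 1/2 - \<delta>] \<union> [1/2, 1]\<close> the final
  \<open>else\<close> is reached only with \<open>r \<ge> n/2\<close>.\<close>

definition kappa ::
  "real \<Rightarrow> (nat \<Rightarrow> real) \<Rightarrow> (nat \<Rightarrow> real) \<Rightarrow> (nat \<Rightarrow> real) \<Rightarrow> (nat \<Rightarrow> real)
    \<Rightarrow> nat \<Rightarrow> real \<Rightarrow> nat \<Rightarrow> real" where
  "kappa \<delta> \<epsilon>1 \<epsilon>2 \<epsilon>3 \<epsilon>4 n \<alpha> r =
    (if real r \<le> real n * (1/2 - \<delta>) then
       if even r then ((real n - 2) gchoose (r - 1)) * (phi \<alpha> + \<epsilon>1 n)
       else ((real n - 2) gchoose (r - 1)) * (phi_hat \<alpha> (real r / real n) + \<epsilon>2 n)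
     else
       if even r then ((real n - 2) gchoose (r + 1)) * (phi \<alpha> + \<epsilon>3 n)
       else ((real n - 2) gchoose r) * (phi \<alpha> + \<epsilon>4 n))"

end

theory Submission
  imports Defs
begin

text \<open>
  Write \<open>\<kappa>\<^sub>k(x) = K\<^sub>k(x) / K\<^sub>k(0)\<close>. Since \<open>\<omega>\<^sub>i\<close> is the Krawtchouk value \<open>K\<^sub>r(i - 1)\<close> for length
  \<open>n - 1\<close>, the constraints compare values of \<open>\<kappa>\<close> for lengths \<open>n\<close> and \<open>n - 1\<close>, and
  every lower bound comes from one explicit feasible point.

  Two estimates on \<open>\<kappa>\<close> decide feasibility. First, \<open>\<bar>\<kappa>\<^sub>k(x)\<bar> \<le> \<bar>\<kappa>\<^sub>k(1)\<bar>\<close> for \<open>0 < x < n\<close> and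
  \<open>2k \<noteq> n\<close>, by induction on \<open>n\<close>: the bound \<open>1 - 2k/n\<close> satisfies the recursion of \<open>\<kappa>\<close> with equality.
  Second, \<open>\<bar>\<kappa>\<^sub>k(x)\<bar> \<le> \<kappa>\<^sub>k(2)\<close> for \<open>2 \<le> x \<le> n - 2\<close>, \<open>2k - n \<ge> \<delta>n\<close> and large \<open>n\<close>: the three-term
  recursion in \<open>x\<close> handles \<open>x\<close> up to about \<open>p = n - k\<close>, the one in \<open>p\<close> handles larger \<open>x\<close>, and the
  gap of boundedly many \<open>x\<close> between the two costs less than the factor \<open>1 - p/n\<close> gained at \<open>x = 3\<close>.

  For (i) the points are supported on one or two adjacent indices. For (ii) the point is a multiple
  of the indicator of \<open>{k..n}\<close> with \<open>k\<close> odd, which only needs the first estimate and has objective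
  at least \<open>f(y) = 2/(1 + y) (1/\<alpha> - 1 - 1/y)\<close> with \<open>y = 2k/n - 1\<close>, up to the binomial factor.
  For \<open>\<alpha> < 1/4\<close> and \<open>a = 1/\<surd>\<alpha>\<close> one has
  \<open>\<phi>(\<alpha>) - f(y) = 2((a - 1)y - 1)\<^sup>2 / (y(1 + y))\<close>, so \<open>\<phi>\<close> is the maximum of \<open>f\<close>.
\<close>

section \<open>Krawtchouk polynomials\<close>

lemma krawtchouk_0_left [simp]: "krawtchouk n 0 x = 1"
  by (simp add: krawtchouk_def)

text \<open>\<open>krawtchouk n k x\<close> is the coefficient of z^k in (1 - z)^x (1 + z)^(n - x).
  Raising n alone multiplies this by 1 + z; in the sum that is Pascal's rule for the second
  factor.\<close>

lemma krawtchouk_Suc_Suc: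
  "krawtchouk (Suc n) (Suc k) x = krawtchouk n (Suc k) x + krawtchouk n k x"
proof -
  have "((real (Suc n) - x) gchoose (Suc k - j)) =
      ((real n - x) gchoose (Suc k - j)) + ((real n - x) gchoose (k - j))" if "j \<le> k" for j
    using that gbinomial_Suc_Suc[of "real n - x" "k - j"]
    by (simp add: Suc_diff_le algebra_simps)
  then show ?thesis
    by (simp add: krawtchouk_def sum.distrib algebra_simps)
qed

text \<open>Raising n and x together multiplies the generating function by 1 - z, hence the minus
  sign.\<close>

lemma krawtchouk_Suc_Suc_add_1:
  "krawtchouk (Suc n) (Suc k) (x + 1) = krawtchouk n (Suc k) x - krawtchouk n k x"
proof -
  have e: "real (Suc n) - (x + 1) = real n - x" by simp
  show ?thesis
    unfolding krawtchouk_def e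
    by (subst (1 2) sum.atLeast0_atMost_Suc_shift)
      (simp add: gbinomial_Suc_Suc[of x] add.commute[of 1 x] sum.distrib distrib_left distrib_right
        left_diff_distrib sum_subtractf sum_negf)
qed

lemma krawtchouk_at_0 [simp]: "krawtchouk n k 0 = real (n choose k)"
proof -
  have "krawtchouk n k 0 = (\<Sum>j\<in>{0}. (-1) ^ j * (0 gchoose j) * ((real n - 0) gchoose (k - j)))"
    unfolding krawtchouk_def
    by (rule sum.mono_neutral_right) (auto simp: gbinomial_0_left)
  then show ?thesis by (simp add: binomial_gbinomial)
qed

text \<open>For integers x <= n the generating function is a polynomial in z of degree n.\<close>

lemma krawtchouk_eq_0: "x \<le> n \<Longrightarrow> n < k \<Longrightarrow> krawtchouk n k (real x) = 0"
proof (induction n arbitrary: k x)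
  case 0
  then show ?case by simp
next
  case (Suc n)
  then obtain k' where k: "k = Suc k'" by (cases k) auto
  show ?case
  proof (cases x)
    case 0
    then show ?thesis using Suc.prems by simp
  next
    case (Suc x')
    then show ?thesis
      using Suc.prems Suc.IH[of x' k] Suc.IH[of x' k'] krawtchouk_Suc_Suc_add_1[of n k' "real x'"]
      by (simp add: k add.commute)
  qed
qed

lemma krawtchouk_reflect: "krawtchouk n k (real n - x) = (-1) ^ k * krawtchouk n k x"
proof -
  have "krawtchouk n k (real n - x) =
      (\<Sum>j=0..k. (-1) ^ (k - j) * ((real n - x) gchoose (k - j)) * (x gchoose j))"
    unfolding krawtchouk_def
    by (subst sum.atLeastAtMost_rev) (simp add: atLeast0AtMost)
  also have "\<dots> = (\<Sum>j=0..k. (-1) ^ k * ((-1) ^ j * (x gchoose j) * ((real n - x) gchoose (k - j))))"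
    by (rule sum.cong) (auto simp: uminus_power_if)
  finally show ?thesis by (simp add: krawtchouk_def sum_distrib_left)
qed

lemma krawtchouk_symmetric:
  "real (n choose x) * krawtchouk n k (real x) = real (n choose k) * krawtchouk n x (real k)"
proof (induction n arbitrary: k x)
  case 0
  have "krawtchouk 0 (Suc m) 0 = 0" for m by simp
  then show ?case by (cases k; cases x) auto
next
  case (Suc n)
  show ?case
  proof (cases "k = 0 \<or> x = 0")
    case True
    then show ?thesis by auto
  next
    case False
    then obtain k' x' where kx: "k = Suc k'" "x = Suc x'" by (auto simp: gr0_conv_Suc)
    \<comment> \<open>Pascal's rule splits the binomial, and each half is paired with the recursion
      that lands on its own argument. Under exchange of a and b the first and last terms are fixed
      and the middle two trade places, so the induction hypothesis finishes.\<close>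
    have rec: "real (Suc n choose Suc b) * krawtchouk (Suc n) (Suc a) (real (Suc b)) =
        real (n choose Suc b) * krawtchouk n (Suc a) (real (Suc b))
        + real (n choose Suc b) * krawtchouk n a (real (Suc b))
        + real (n choose b) * krawtchouk n (Suc a) (real b)
        - real (n choose b) * krawtchouk n a (real b)" for a b
    proof -
      have 1: "krawtchouk (Suc n) (Suc a) (real (Suc b))
          = krawtchouk n (Suc a) (real (Suc b)) + krawtchouk n a (real (Suc b))"
        by (rule krawtchouk_Suc_Suc)
      have 2: "krawtchouk (Suc n) (Suc a) (real (Suc b))
          = krawtchouk n (Suc a) (real b) - krawtchouk n a (real b)"
        using krawtchouk_Suc_Suc_add_1[of n a "real b"] by (simp add: add.commute)
      have "real (Suc n choose Suc b) * krawtchouk (Suc n) (Suc a) (real (Suc b))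
          = real (n choose Suc b) * krawtchouk (Suc n) (Suc a) (real (Suc b))
          + real (n choose b) * krawtchouk (Suc n) (Suc a) (real (Suc b))"
        by (simp add: distrib_right)
      also have "\<dots> = real (n choose Suc b) * (krawtchouk n (Suc a) (real (Suc b)) + krawtchouk n a (real (Suc b)))
          + real (n choose b) * (krawtchouk n (Suc a) (real b) - krawtchouk n a (real b))"
        using 1 2 by simp
      finally show ?thesis by (simp add: algebra_simps)
    qed
    show ?thesis
      unfolding kx rec
      using Suc.IH[of "Suc x'" "Suc k'"] Suc.IH[of "Suc x'" k'] Suc.IH[of x' "Suc k'"] Suc.IH[of x' k']
      by simp
  qed
qed

section \<open>Normalized values and their symmetries\<close>

definition kap :: "nat \<Rightarrow> nat \<Rightarrow> nat \<Rightarrow> real" where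
  "kap n k x = krawtchouk n k (real x) / real (n choose k)"

lemma krawtchouk_eq_kap: "k \<le> n \<Longrightarrow> krawtchouk n k (real x) = real (n choose k) * kap n k x"
  by (simp add: kap_def)

lemma kap_symmetric: "k \<le> n \<Longrightarrow> x \<le> n \<Longrightarrow> kap n k x = kap n x k"
  using krawtchouk_symmetric[of n x k] by (simp add: kap_def field_simps)

lemma kap_at_0 [simp]: "k \<le> n \<Longrightarrow> kap n k 0 = 1" 
  by (simp add: kap_def)

lemma kap_0_left [simp]: "kap n 0 x = 1"
  by (simp add: kap_def)

lemma kap_reflect: "x \<le> n \<Longrightarrow> kap n k (n - x) = (-1) ^ k * kap n k x"
  using krawtchouk_reflect[of n k "real x"] by (simp add: kap_def of_nat_diff)

lemma kap_reflect_left: "k \<le> n \<Longrightarrow> x \<le> n \<Longrightarrow> kap n (n - k) x = (-1) ^ x * kap n k x"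
  using kap_reflect[of k n x] by (simp add: kap_symmetric[of _ n x])

lemma binomial_ratios:
  assumes "k < n"
  shows "real (Suc n) * real (n choose Suc k) = real (n - k) * real (Suc n choose Suc k)"
    "real (Suc n) * real (n choose k) = real (Suc k) * real (Suc n choose Suc k)"
proof -
  show *: "real (Suc n) * real (n choose k) = real (Suc k) * real (Suc n choose Suc k)"
    using Suc_times_binomial_eq[of n k] by (metis mult.commute of_nat_mult)
  have "real (Suc n choose Suc k) = real (n choose k) + real (n choose Suc k)" by simp
  then show "real (Suc n) * real (n choose Suc k) = real (n - k) * real (Suc n choose Suc k)"
    using * assms by (simp add: of_nat_diff algebra_simps)
qed

text \<open>The weights \<open>Suc n - k\<close> and \<open>k\<close> add up to
  \<open>Suc n\<close>, so passing to length n + 1 averages two neighbouring values, with a sign if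
  the argument moves as well. At k = 0 and k = n + 1 the index that falls outside the range has
  weight zero.\<close>

lemma kap_Suc:
  assumes "x \<le> n" "k \<le> Suc n"
  shows "real (Suc n) * kap (Suc n) k x = real (Suc n - k) * kap n k x + real k * kap n (k - 1) x"
    "real (Suc n) * kap (Suc n) k (Suc x) = real (Suc n - k) * kap n k x - real k * kap n (k - 1) x"
proof -
  have A: "real (Suc n) * (krawtchouk n (Suc l) (real x) / (Suc n choose Suc l)) = real (n - l) * kap n (Suc l) x"
       "real (Suc n) * (krawtchouk n l (real x) / (Suc n choose Suc l)) = real (Suc l) * kap n l x" if "l \<le> n" for l
  proof -
    have p: "real (Suc n choose Suc l) > 0" "real (n choose l) > 0" using that by (simp_all del: binomial_Suc_Suc)
    show "real (Suc n) * (krawtchouk n l (real x) / (Suc n choose Suc l)) = real (Suc l) * kap n l x"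
      using p Suc_times_binomial_eq[of n l] unfolding kap_def
      by (simp add: field_simps del: binomial_Suc_Suc of_nat_Suc flip: of_nat_mult)
    show "real (Suc n) * (krawtchouk n (Suc l) (real x) / (Suc n choose Suc l)) = real (n - l) * kap n (Suc l) x"
    proof (cases "l = n")
      case True then show ?thesis using krawtchouk_eq_0[OF assms(1), of "Suc n"] by simp
    next
      case False
      then have l: "l < n" using that by simp
      then have q: "real (n choose Suc l) > 0" by simp
      have "real (Suc n) / real (Suc n choose Suc l) = real (n - l) / real (n choose Suc l)"
        using p q binomial_ratios(1)[OF l] by (simp add: frac_eq_eq del: binomial_Suc_Suc of_nat_Suc)
      then show ?thesis unfolding kap_def
        by (simp add: divide_inverse mult_ac del: binomial_Suc_Suc of_nat_Suc)
    qed
  qed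
  show "real (Suc n) * kap (Suc n) k x = real (Suc n - k) * kap n k x + real k * kap n (k - 1) x"
  proof (cases k)
    case (Suc l)
    then have "l \<le> n" using assms by simp
    then show ?thesis using A[of l] krawtchouk_Suc_Suc[of n l "real x"]
      unfolding Suc kap_def[of "Suc n"]
      by (simp add: add_divide_distrib distrib_left del: binomial_Suc_Suc of_nat_Suc)
  qed simp
  show "real (Suc n) * kap (Suc n) k (Suc x) = real (Suc n - k) * kap n k x - real k * kap n (k - 1) x"
  proof (cases k)
    case (Suc l)
    then have "l \<le> n" using assms by simp
    moreover have "krawtchouk (Suc n) (Suc l) (real (Suc x)) = krawtchouk n (Suc l) (real x) - krawtchouk n l (real x)"
      using krawtchouk_Suc_Suc_add_1[of n l "real x"] by (simp add: add.commute)
    ultimately show ?thesis using A[of l] 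
      unfolding Suc kap_def[of "Suc n"]
      by (simp add: diff_divide_distrib right_diff_distrib del: binomial_Suc_Suc of_nat_Suc)
  qed simp
qed

section \<open>Bounds on normalized Krawtchouk polynomials\<close>

lemma Suc_times_binomial_real:
  "real (Suc k) * real (n choose Suc k) = (real n - real k) * real (n choose k)"
  using gbinomial_mult_1[of "real n" k] by (simp add: binomial_gbinomial algebra_simps)

lemma krawtchouk_1_left [simp]: "krawtchouk n (Suc 0) x = real n - 2 * x"
  by (simp add: krawtchouk_def)

text \<open>This is the coefficient form of (1 - z^2) G' = (n - 2x - n z) G for the generating
  function G. The induction starts at n = x, where the values are signed binomials; the relation for
  n + 1 is the sum of two consecutive relations for n.\<close>

lemma krawtchouk_three_term:
  assumes "x \<le> n"
  shows "real (k + 2) * krawtchouk n (Suc (Suc k)) (real x) =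
    (real n - 2 * real x) * krawtchouk n (Suc k) (real x)
    - (real n - real k) * krawtchouk n k (real x)"
  using assms
proof (induction n arbitrary: k rule: dec_induct)
  case base
  have v: "krawtchouk x l (real x) = (-1) ^ l * real (x choose l)" for l
    using krawtchouk_reflect[of x l 0] by simp
  have "real (k + 2) * real (x choose Suc (Suc k)) = (real x - real (Suc k)) * real (x choose Suc k)"
    using Suc_times_binomial_real[of "Suc k" x] by simp
  also have "\<dots> = real x * real (x choose Suc k) - (real x - real k) * real (x choose k)"
    using Suc_times_binomial_real[of k x] by (simp add: algebra_simps)
  finally have e: "real (k + 2) * real (x choose Suc (Suc k))
      = real x * real (x choose Suc k) - (real x - real k) * real (x choose k)" .
  have "real (k + 2) * krawtchouk x (Suc (Suc k)) (real x)
      = (-1) ^ k * (real (k + 2) * real (x choose Suc (Suc k)))"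
    by (simp add: v)
  also have "\<dots> = (real x - 2 * real x) * krawtchouk x (Suc k) (real x)
      - (real x - real k) * krawtchouk x k (real x)"
    unfolding e by (simp add: v algebra_simps)
  finally show ?case .
next
  case (step n)
  show ?case
  proof (cases k)
    case 0
    have "2 * krawtchouk n (Suc (Suc 0)) (real x)
        = (real n - 2 * real x) * (real n - 2 * real x) - real n"
      using step.IH[of 0] by simp
    then show ?thesis
      by (simp add: 0 krawtchouk_Suc_Suc algebra_simps)
  next
    case (Suc l)
    define A where "A = krawtchouk n (Suc (Suc (Suc l))) (real x)"
    define B where "B = krawtchouk n (Suc (Suc l)) (real x)"
    define C where "C = krawtchouk n (Suc l) (real x)"
    define D where "D = krawtchouk n l (real x)"
    have 1: "(real l + 3) * A = (real n - 2 * real x) * B - (real n - (real l + 1)) * C"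
      using step.IH[of "Suc l"] by (simp add: A_def B_def C_def algebra_simps)
    have 2: "(real l + 2) * B = (real n - 2 * real x) * C - (real n - real l) * D"
      using step.IH[of l] by (simp add: B_def C_def D_def algebra_simps)
    have "(real l + 3) * (A + B) =
        (real n + 1 - 2 * real x) * (B + C) - (real n + 1 - (real l + 1)) * (C + D)"
      using 1 2 by algebra
    then show ?thesis
      by (simp add: Suc krawtchouk_Suc_Suc A_def B_def C_def D_def algebra_simps)
  qed
qed

lemma kap_three_term_left:
  assumes "x \<le> n" "k + 2 \<le> n"
  shows "(real n - real k - 1) * kap n (k + 2) x =
    (real n - 2 * real x) * kap n (k + 1) x - (real k + 1) * kap n k x"
proof -
  define c where "c = real (n choose (k + 1))"
  have c: "c > 0" using assms by (simp add: c_def)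
  have 1: "real (k + 2) * real (n choose (k + 2)) = (real n - real k - 1) * c"
    using Suc_times_binomial_real[of "k + 1" n] by (simp add: c_def algebra_simps)
  have 2: "(real n - real k) * real (n choose k) = (real k + 1) * c"
    using Suc_times_binomial_real[of k n] by (simp add: c_def algebra_simps)
  have "real (k + 2) * (real (n choose (k + 2)) * kap n (k + 2) x) =
      (real n - 2 * real x) * (c * kap n (k + 1) x)
      - (real n - real k) * (real (n choose k) * kap n k x)"
    using krawtchouk_three_term[OF assms(1), of k] assms(2)
    by (simp add: krawtchouk_eq_kap c_def)
  then have "c * ((real n - real k - 1) * kap n (k + 2) x) =
      c * ((real n - 2 * real x) * kap n (k + 1) x - (real k + 1) * kap n k x)"
    using 1 2 by algebra
  then show ?thesis using c by simp
qed

text \<open>The symmetry of \<open>kap\<close> turns the recursion in the index into one in the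
  argument.\<close>

lemma kap_three_term:
  assumes "k \<le> n" "x + 2 \<le> n"
  shows "(real n - real x - 1) * kap n k (x + 2) =
    (real n - 2 * real k) * kap n k (x + 1) - (real x + 1) * kap n k x"
  using kap_three_term_left[OF assms] assms by (simp add: kap_symmetric[of k])

lemma kap_at_1:
  assumes "k \<le> n" "1 \<le> n"
  shows "kap n k (Suc 0) = 1 - 2 * real k / real n"
proof -
  have "kap n k (Suc 0) = kap n (Suc 0) k" using assms by (intro kap_symmetric) auto
  then show ?thesis using assms by (simp add: kap_def field_simps)
qed

lemma kap_at_2:
  assumes "k \<le> n" "2 \<le> n"
  shows "kap n k 2 = ((real n - 2 * real k)\<^sup>2 - real n) / (real n * (real n - 1))"
proof -
  have "(real n - 1) * kap n k 2 = (real n - 2 * real k) * (1 - 2 * real k / real n) - 1"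
    using kap_three_term[of k n 0] kap_at_1[of k n] assms by (simp add: numeral_2_eq_2)
  also have "\<dots> = ((real n - 2 * real k)\<^sup>2 - real n) / real n"
    using assms by (simp add: field_simps power2_eq_square)
  finally show ?thesis using assms by (simp add: field_simps)
qed

lemma kap_at_3:
  assumes "k \<le> n" "3 \<le> n"
  shows "kap n k 3 = (real n - 2 * real k) * ((real n - 2 * real k)\<^sup>2 - 3 * real n + 2)
    / (real n * (real n - 1) * (real n - 2))"
proof -
  define d where "d = real n - 2 * real k"
  have n: "real n \<ge> 3" using assms by simp
  have "(real n - 2) * kap n k 3 = d * kap n k 2 - 2 * kap n k 1"
    using kap_three_term[of k n 1] assms by (simp add: numeral_3_eq_3 numeral_2_eq_2 d_def)
  also have "\<dots> = d * ((d\<^sup>2 - real n) / (real n * (real n - 1))) - 2 * (d / real n)"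
    using assms n by (simp add: kap_at_2 kap_at_1 d_def diff_divide_distrib)
  also have "\<dots> = d * (d\<^sup>2 - 3 * real n + 2) / (real n * (real n - 1))"
    using n by (simp add: field_simps)
  finally have e: "(real n - 2) * kap n k 3 = d * (d\<^sup>2 - 3 * real n + 2) / (real n * (real n - 1))" .
  have "kap n k 3 = (real n - 2) * kap n k 3 / (real n - 2)" using n by simp
  then show ?thesis unfolding e by (simp add: d_def)
qed

lemma kap_at_top: "k \<le> n \<Longrightarrow> kap n k n = (-1) ^ k"
  using kap_reflect[of 0 n k] by simp

lemma kap_self_left: "x \<le> n \<Longrightarrow> kap n n x = (-1) ^ x"
  using kap_symmetric[of n n x] kap_at_top by simp

lemma abs_kap_reflect: "x \<le> n \<Longrightarrow> \<bar>kap n k (n - x)\<bar> = \<bar>kap n k x\<bar>"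
  by (simp add: kap_reflect abs_mult)

lemma abs_kap_reflect_left: "k \<le> n \<Longrightarrow> x \<le> n \<Longrightarrow> \<bar>kap n (n - k) x\<bar> = \<bar>kap n k x\<bar>"
  by (simp add: kap_reflect_left abs_mult)

text \<open>Reflecting the index fixes the middle one but changes the sign at odd arguments.\<close>

lemma kap_middle_eq_0: "odd x \<Longrightarrow> x \<le> 2 * k \<Longrightarrow> kap (2 * k) k x = 0"
  using kap_reflect_left[of k "2 * k" x] by (simp add: uminus_power_if)

section \<open>Bounds by induction on the length\<close>

lemma abs_kap_Suc_le:
  assumes "x \<le> n" "k \<le> Suc n" "z = x \<or> z = Suc x"
  shows "real (Suc n) * \<bar>kap (Suc n) k z\<bar> \<le>
    real (Suc n - k) * \<bar>kap n k x\<bar> + real k * \<bar>kap n (k - 1) x\<bar>"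
proof -
  have "real (Suc n) * \<bar>kap (Suc n) k z\<bar> = \<bar>real (Suc n) * kap (Suc n) k z\<bar>"
    by (simp add: abs_mult)
  also have "\<dots> \<le> \<bar>real (Suc n - k) * kap n k x\<bar> + \<bar>real k * kap n (k - 1) x\<bar>"
    using assms kap_Suc[OF assms(1,2)]
    by (auto intro: abs_triangle_ineq abs_triangle_ineq4 simp del: of_nat_Suc)
  finally show ?thesis by (simp add: abs_mult)
qed

lemma abs_kap_le_1: "x \<le> n \<Longrightarrow> k \<le> n \<Longrightarrow> \<bar>kap n k x\<bar> \<le> 1"
proof (induction n arbitrary: k x)
  case 0
  then show ?case by simp
next
  case (Suc n)
  obtain w where w: "w \<le> n" "x = w \<or> x = Suc w" using Suc.prems by (cases x) auto
  have 1: "real (Suc n - k) * \<bar>kap n k w\<bar> \<le> real (Suc n - k)"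
  proof (cases "k \<le> n")
    case True
    then show ?thesis using Suc.IH[OF w(1), of k] by (intro mult_left_le) auto
  next
    case False
    then have "k = Suc n" using Suc.prems by simp
    then show ?thesis by simp
  qed
  have 2: "real k * \<bar>kap n (k - 1) w\<bar> \<le> real k"
    using Suc.IH[OF w(1), of "k - 1"] Suc.prems by (intro mult_left_le) auto
  have "real (Suc n) * \<bar>kap (Suc n) k x\<bar> \<le> real (Suc n - k) + real k"
    using abs_kap_Suc_le[OF w(1) Suc.prems(2) w(2)] 1 2 by linarith
  then have "real (Suc n) * \<bar>kap (Suc n) k x\<bar> \<le> real (Suc n) * 1"
    using Suc.prems by (simp add: of_nat_diff)
  then show ?case by (simp only: mult_le_cancel_left_pos of_nat_0_less_iff zero_less_Suc)
qed

text \<open>The function \<open>1 - 2k/n\<close> satisfies the recursion for \<open>kap\<close> in \<open>n\<close> with equality, so bounds by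
  multiples of it propagate. At the edge \<open>n = 2k\<close>, where it vanishes, one steps to an odd argument,
  where \<open>kap\<close> vanishes as well.\<close>

lemma abs_kap_step:
  assumes x: "x \<le> n" "z = x \<or> z = Suc x" and k: "2 * k \<le> n" and c: "0 \<le> c"
    and edge: "2 * k = n \<Longrightarrow> odd x"
    and b1: "2 * k < n \<Longrightarrow> \<bar>kap n k x\<bar> \<le> (1 - 2 * real k / real n) * c"
    and b2: "k > 0 \<Longrightarrow> \<bar>kap n (k - 1) x\<bar> \<le> (1 - 2 * real (k - 1) / real n) * c"
    and n: "n > 0"
  shows "\<bar>kap (Suc n) k z\<bar> \<le> (1 - 2 * real k / real (Suc n)) * c"
proof -
  have 1: "\<bar>kap n k x\<bar> \<le> (1 - 2 * real k / real n) * c"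
  proof (cases "2 * k = n")
    case True
    then have "kap n k x = 0" using kap_middle_eq_0[of x k] edge x by simp
    then show ?thesis using True n by auto
  qed (use b1 k in simp)
  have 2: "real k * \<bar>kap n (k - 1) x\<bar> \<le> real k * ((1 - 2 * (real k - 1) / real n) * c)"
    using b2 by (cases "k = 0") (auto simp: of_nat_diff intro!: mult_left_mono)
  have "real (Suc n) * \<bar>kap (Suc n) k z\<bar> \<le>
      (real n + 1 - real k) * ((1 - 2 * real k / real n) * c)
      + real k * ((1 - 2 * (real k - 1) / real n) * c)"
  proof -
    have "(real n + 1 - real k) * \<bar>kap n k x\<bar> \<le> (real n + 1 - real k) * ((1 - 2 * real k / real n) * c)"
      using k by (intro mult_left_mono[OF 1]) auto
    moreover have e: "real (Suc n - k) = real n + 1 - real k" using k by (simp add: of_nat_diff)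
    have "k \<le> Suc n" using k by simp
    note abs_kap_Suc_le[OF x(1) this x(2), unfolded e]
    ultimately show ?thesis using 2 by linarith
  qed
  also have "\<dots> = real (Suc n) * ((1 - 2 * real k / real (Suc n)) * c)"
    using n by (simp add: field_simps)
  finally show ?thesis by (simp only: mult_le_cancel_left_pos of_nat_0_less_iff zero_less_Suc)
qed

lemma abs_kap_le:
  assumes "2 * k < n" "1 \<le> x" "x < n"
  shows "\<bar>kap n k x\<bar> \<le> 1 - 2 * real k / real n"
  using assms
proof (induction n arbitrary: k x)
  case 0
  then show ?case by simp
next
  case (Suc n)
  show ?case
  proof (cases "n \<le> 1")
    case True
    then have "n = 1" "k = 0" using Suc.prems by auto
    then show ?thesis by simp
  next
    case False
    \<comment> \<open>Either x or x - 1 may serve as the argument at length n. It has to stay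
      strictly between 0 and n, and has to be odd when 2k = n; the only conflict would be x = n odd,
      where 2k = n is impossible.\<close>
    obtain w where w: "1 \<le> w" "w < n" "x = w \<or> x = Suc w" "2 * k = n \<Longrightarrow> odd w"
    proof (cases "odd x \<and> x < n \<or> x = 1")
      case True
      then show ?thesis using Suc.prems False by (intro that[of x]) auto
    next
      case F: False
      show ?thesis
      proof (cases "odd x")
        case True
        then have "2 * k \<noteq> n" using Suc.prems F by presburger
        then show ?thesis using Suc.prems F True False by (intro that[of "x - 1"]) auto
      next
        case ev: False
        then show ?thesis using Suc.prems F False by (intro that[of "x - 1"]) auto
      qed
    qed
    have "\<bar>kap (Suc n) k x\<bar> \<le> (1 - 2 * real k / real (Suc n)) * 1"
    proof (rule abs_kap_step[of w])
      show "k > 0 \<Longrightarrow> \<bar>kap n (k - 1) w\<bar> \<le> (1 - 2 * real (k - 1) / real n) * 1"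
        using Suc.IH[of "k - 1" w] w Suc.prems by auto
    qed (use w Suc.prems Suc.IH[of k w] False in auto)
    then show ?thesis by simp
  qed
qed

lemma abs_kap_le':
  assumes "n < 2 * k" "k \<le> n" "1 \<le> x" "x < n"
  shows "\<bar>kap n k x\<bar> \<le> 2 * real k / real n - 1"
proof -
  have "\<bar>kap n (n - k) x\<bar> \<le> 1 - 2 * real (n - k) / real n"
    using assms by (intro abs_kap_le) auto
  also have "\<dots> = 2 * real k / real n - 1"
    using assms by (simp add: of_nat_diff field_simps)
  finally show ?thesis using abs_kap_reflect_left[of k n x] assms by simp
qed

text \<open>In the middle 1 - 2k/n is zero and cannot bound the values at even arguments. One step
  down, to length 2k - 1, both indices k and k - 1 lie next to the middle, and there the general
  bounds give 1/(2k - 1).\<close>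

lemma abs_kap_middle_le:
  assumes "1 \<le> x" "x < 2 * k"
  shows "\<bar>kap (2 * k) k x\<bar> \<le> 1 / (2 * real k - 1)"
proof (cases "odd x")
  case True
  then show ?thesis using kap_middle_eq_0[of x k] assms by simp
next
  case False
  then have x: "2 \<le> x" "x - 1 < 2 * k - 1" "Suc (x - 1) = x" using assms by (cases "x = 1"; auto)+
  define m where "m = 2 * k - 1"
  have m: "2 * k = Suc m" "real m = 2 * real k - 1" using assms by (auto simp: m_def of_nat_diff)
  have k: "k \<ge> 2" using x assms False by presburger
  have 1: "\<bar>kap m k (x - 1)\<bar> \<le> 1 / real m"
  proof -
    have "2 * real k / real m - 1 = 1 / real m" using m k by (simp add: field_simps)
    moreover have "m < 2 * k" "k \<le> m" "1 \<le> x - 1" "x - 1 < m" using x k by (auto simp: m_def)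
    ultimately show ?thesis using abs_kap_le'[of m k "x - 1"] by linarith
  qed
  have 2: "\<bar>kap m (k - 1) (x - 1)\<bar> \<le> 1 / real m"
  proof -
    have "1 - 2 * real (k - 1) / real m = 1 / real m" using m k by (simp add: of_nat_diff field_simps)
    moreover have "2 * (k - 1) < m" "1 \<le> x - 1" "x - 1 < m" using x k by (auto simp: m_def)
    ultimately show ?thesis using abs_kap_le[of "k - 1" m "x - 1"] by linarith
  qed
  have "real (Suc m) * \<bar>kap (Suc m) k x\<bar> \<le> real (Suc m - k) * (1 / real m) + real k * (1 / real m)"
  proof -
    have "x - 1 \<le> m" "k \<le> Suc m" using x k by (auto simp: m_def)
    from abs_kap_Suc_le[OF this, of x] show ?thesis
      using x(3) mult_left_mono[OF 1, of "real (Suc m - k)"] mult_left_mono[OF 2, of "real k"]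
      by linarith
  qed
  also have "\<dots> = real (Suc m) * (1 / real m)"
  proof -
    have "real (Suc m - k) + real k = real (Suc m)" using k m(1) by linarith
    then show ?thesis by (simp only: distrib_right[symmetric])
  qed
  finally have "\<bar>kap (Suc m) k x\<bar> \<le> 1 / real m"
    by (simp only: mult_le_cancel_left_pos of_nat_0_less_iff zero_less_Suc)
  then show ?thesis unfolding m(1) m(2)[symmetric] .
qed

text \<open>The extra factor serves the borderline case n = 2r + 1 below. It increases with n, so
  the step of the previous induction still works. The start n = 7 is forced: at x = 3 and k = (n -
  1)/2 the claim reads 3 <= n - 4. The index k = 1 is done directly, since the recursion would lead
  to k = 0, where \<open>kap\<close> is 1.\<close>

lemma abs_kap_le_sharp:
  assumes "7 \<le> n" "1 \<le> k" "2 * k < n" "3 \<le> x" "x + 3 \<le> n"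
  shows "\<bar>kap n k x\<bar> \<le> (1 - 2 * real k / real n) * (1 - 2 / (real n - 2))"
  using assms
proof (induction n arbitrary: k x rule: dec_induct)
  case base
  have k: "k = 1 \<or> k = 2 \<or> k = 3" using base by auto
  have x: "x = 3 \<or> x = 7 - 3" using base by auto
  have "\<bar>kap 7 k x\<bar> = \<bar>kap 7 k 3\<bar>" using x abs_kap_reflect[of 3 7 k] by auto
  then show ?case using k by (auto simp: kap_at_3)
next
  case (step n)
  note prems = step.prems
  show ?case
  proof (cases "k = 1")
    case True
    have "kap (Suc n) k x = 1 - 2 * real x / real (Suc n)"
      using kap_symmetric[of k "Suc n" x] kap_at_1[of x "Suc n"] prems True by simp
    moreover have "\<bar>1 - 2 * real x / real (Suc n)\<bar> \<le> 1 - 6 / real (Suc n)"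
    proof -
      have "6 / real (Suc n) \<le> 2 * real x / real (Suc n)" 
        using prems by (intro divide_right_mono) auto
      moreover have "(2 * real x + 6) / real (Suc n) \<le> 2"
        using prems by (simp add: divide_le_eq)
      then have "2 * real x / real (Suc n) \<le> 2 - 6 / real (Suc n)"
        unfolding add_divide_distrib by linarith
      ultimately show ?thesis by linarith
    qed
    moreover have "1 - 6 / real (Suc n) \<le> (1 - 2 * real 1 / real (Suc n)) * (1 - 2 / (real (Suc n) - 2))"
    proof -
      have n: "real n \<ge> 7" using step by simp
      have 1: "1 - 2 * real 1 / real (Suc n) = (real n - 1) / (real n + 1)"
        "1 - 2 / (real (Suc n) - 2) = (real n - 3) / (real n - 1)"
        "1 - 6 / real (Suc n) = (real n - 5) / (real n + 1)"
        using n by (simp_all add: field_simps)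
      show ?thesis unfolding 1 using n by (simp add: divide_right_mono)
    qed
    ultimately show ?thesis unfolding True by linarith
  next
    case False
    obtain w where w: "3 \<le> w" "w + 3 \<le> n" "x = w \<or> x = Suc w" "2 * k = n \<Longrightarrow> odd w"
    proof (cases "odd x \<and> x + 3 \<le> n \<or> x = 3")
      case True
      then show ?thesis using prems step by (intro that[of x]) auto
    next
      case F: False
      show ?thesis
      proof (cases "odd x")
        case True
        then have "2 * k \<noteq> n" using F prems by presburger
        then show ?thesis using prems F True by (intro that[of "x - 1"]) auto
      next
        case ev: False
        then show ?thesis using prems F by (intro that[of "x - 1"]) auto
      qed
    qed
    have "\<bar>kap (Suc n) k x\<bar> \<le> (1 - 2 * real k / real (Suc n)) * (1 - 2 / (real n - 2))"
    proof (rule abs_kap_step[of w])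
      show "k > 0 \<Longrightarrow> \<bar>kap n (k - 1) w\<bar> \<le> (1 - 2 * real (k - 1) / real n) * (1 - 2 / (real n - 2))"
        using step.IH[of "k - 1" w] w prems False by auto
    qed (use w prems step.IH[of k w] step.hyps False in auto)
    also have "\<dots> \<le> (1 - 2 * real k / real (Suc n)) * (1 - 2 / (real (Suc n) - 2))"
    proof (intro mult_left_mono diff_left_mono)
      show "2 / (real (Suc n) - 2) \<le> 2 / (real n - 2)" using step.hyps by (intro frac_le) auto
      show "0 \<le> 1 - 2 * real k / real (Suc n)" using prems by (simp add: divide_le_eq)
    qed
    finally show ?thesis .
  qed
qed

section \<open>Domination by the value at 2\<close>

text \<open>Induction on the index. The triangle inequality loses the sign of the term
  \<open>(k + 1) * kap n k\<close>, which costs twice that term, while replacing n - 2i by n - 4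
  gains \<open>(2 * i - 4) * kap n (k + 1) 2\<close>; hypothesis \<open>step\<close> says that the
  gain covers the cost.\<close>

lemma abs_kap_le_kap_2_of_small_index:
  assumes i: "2 \<le> i" "2 * i \<le> n" and P: "P \<le> n"
    and step: "\<And>k. k + 2 \<le> P \<Longrightarrow> (real k + 1) * kap n k 2 \<le> (real i - 2) * kap n (k + 1) 2"
  shows "p \<le> P \<Longrightarrow> \<bar>kap n p i\<bar> \<le> kap n p 2"
proof -
  have "(k \<le> P \<longrightarrow> \<bar>kap n k i\<bar> \<le> kap n k 2) \<and> (k + 1 \<le> P \<longrightarrow> \<bar>kap n (k + 1) i\<bar> \<le> kap n (k + 1) 2)" for k
  proof (induction k)
    case 0
    have "\<bar>kap n 1 i\<bar> \<le> kap n 1 2" if "1 \<le> P"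
    proof -
      have n: "real n > 0" "2 * real i \<le> real n" using i by auto
      have v: "kap n 1 j = 1 - 2 * real j / real n" if "j \<le> n" for j
        using kap_symmetric[of 1 n j] kap_at_1[of j n] that i by simp
      have "2 * real i / real n \<le> 1" using n by simp
      moreover have "2 * 2 / real n \<le> 2 * real i / real n" using n i by (intro divide_right_mono) auto
      ultimately show ?thesis using v[of i] v[of 2] i by simp
    qed
    then show ?case using i by simp
  next
    case (Suc k)
    have "\<bar>kap n (k + 2) i\<bar> \<le> kap n (k + 2) 2" if kP: "k + 2 \<le> P"
    proof -
      have pos: "real n - real k - 1 > 0" using kP P by linarith
      have IH: "\<bar>kap n k i\<bar> \<le> kap n k 2" "\<bar>kap n (k + 1) i\<bar> \<le> kap n (k + 1) 2"
        using Suc kP by auto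
      have "(real n - real k - 1) * \<bar>kap n (k + 2) i\<bar>
          = \<bar>(real n - 2 * real i) * kap n (k + 1) i - (real k + 1) * kap n k i\<bar>"
      proof -
        have "(real n - real k - 1) * kap n (k + 2) i =
            (real n - 2 * real i) * kap n (k + 1) i - (real k + 1) * kap n k i"
          using i kP P by (intro kap_three_term_left) auto
        from this[symmetric] show ?thesis using pos by (simp only: abs_mult abs_of_pos)
      qed
      also have "\<dots> \<le> \<bar>(real n - 2 * real i) * kap n (k + 1) i\<bar> + \<bar>(real k + 1) * kap n k i\<bar>"
        by (rule abs_triangle_ineq4)
      also have "\<dots> = (real n - 2 * real i) * \<bar>kap n (k + 1) i\<bar> + (real k + 1) * \<bar>kap n k i\<bar>"
        using i by (simp add: abs_mult)
      also have "\<dots> \<le> (real n - 2 * real i) * kap n (k + 1) 2 + (real k + 1) * kap n k 2"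
        using IH i by (intro add_mono mult_left_mono) auto
      also have "\<dots> \<le> (real n - 4) * kap n (k + 1) 2 - (real k + 1) * kap n k 2"
        using step[OF kP] by (simp add: algebra_simps)
      also have "\<dots> = (real n - real k - 1) * kap n (k + 2) 2"
        using kap_three_term_left[of 2 n k] i kP P by simp
      finally show ?thesis using pos by simp
    qed
    then show ?case using Suc by simp
  qed
  then show "p \<le> P \<Longrightarrow> \<bar>kap n p i\<bar> \<le> kap n p 2" by blast
qed

text \<open>Induction on the argument. Up to i = k the coefficients satisfy n - 2k + i <= n - i, so
  the bound M persists; each later step costs a factor R. Truncated subtraction makes the exponent
  zero up to i = k + 1.\<close>

lemma abs_kap_le_of_large_index:
  assumes k: "k \<le> n" and I: "2 * I \<le> n" and R: "1 \<le> R" and k2: "2 * k \<le> n"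
    and M: "\<bar>kap n k 3\<bar> \<le> M" "\<bar>kap n k 4\<bar> \<le> M"
    and step: "\<And>i. k < i \<Longrightarrow> i < I \<Longrightarrow> real n - 2 * real k + real i \<le> R * (real n - real i)"
  shows "3 \<le> i \<Longrightarrow> i \<le> I \<Longrightarrow> \<bar>kap n k i\<bar> \<le> M * R ^ (i - (k + 1))"
proof -
  have M0: "0 \<le> M" using M by linarith
  have base: "M \<le> M * R ^ m" for m
    using mult_left_mono[OF one_le_power[OF R, of m] M0] by simp
  have "(j + 3 \<le> I \<longrightarrow> \<bar>kap n k (j + 3)\<bar> \<le> M * R ^ (j + 3 - (k + 1))) \<and>
    (j + 4 \<le> I \<longrightarrow> \<bar>kap n k (j + 4)\<bar> \<le> M * R ^ (j + 4 - (k + 1)))" for j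
  proof (induction j)
    case 0
    then show ?case using M base order_trans by (auto simp del: power_Suc)
  next
    case (Suc j)
    have "\<bar>kap n k (j + 5)\<bar> \<le> M * R ^ (j + 5 - (k + 1))" if jI: "j + 5 \<le> I"
    proof -
      define i where "i = j + 4"
      have pos: "real n - real i > 0" using jI I by (simp add: i_def)
      have IH: "\<bar>kap n k (j + 3)\<bar> \<le> M * R ^ (i - (k + 1))" "\<bar>kap n k i\<bar> \<le> M * R ^ (i - (k + 1))"
      proof -
        have "\<bar>kap n k (j + 3)\<bar> \<le> M * R ^ (j + 3 - (k + 1))" using Suc jI by simp
        also have "\<dots> \<le> M * R ^ (i - (k + 1))"
          using M0 R by (intro mult_left_mono power_increasing) (auto simp: i_def)
        finally show "\<bar>kap n k (j + 3)\<bar> \<le> M * R ^ (i - (k + 1))" .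
        show "\<bar>kap n k i\<bar> \<le> M * R ^ (i - (k + 1))" using Suc jI by (simp add: i_def)
      qed
      have three: "(real n - real i) * kap n k (j + 5) = (real n - 2 * real k) * kap n k i - real i * kap n k (j + 3)"
        using kap_three_term[of k n "j + 3"] k jI I by (simp add: i_def add.commute diff_diff_eq)
      have "(real n - real i) * \<bar>kap n k (j + 5)\<bar>
          = \<bar>(real n - 2 * real k) * kap n k i - real i * kap n k (j + 3)\<bar>"
        unfolding three[symmetric] using pos by (simp add: abs_mult)
      also have "\<dots> \<le> \<bar>(real n - 2 * real k) * kap n k i\<bar> + \<bar>real i * kap n k (j + 3)\<bar>"
        by (rule abs_triangle_ineq4)
      also have "\<dots> = (real n - 2 * real k) * \<bar>kap n k i\<bar> + real i * \<bar>kap n k (j + 3)\<bar>"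
        using k2 by (simp add: abs_mult)
      also have "\<dots> \<le> (real n - 2 * real k) * (M * R ^ (i - (k + 1))) + real i * (M * R ^ (i - (k + 1)))"
        using IH k2 by (intro add_mono mult_left_mono) auto
      also have "\<dots> = (real n - 2 * real k + real i) * (M * R ^ (i - (k + 1)))"
        by (simp add: algebra_simps)
      also have "\<dots> \<le> (real n - real i) * (M * R ^ (j + 5 - (k + 1)))"
      proof (cases "i \<le> k")
        case True
        then have "M * R ^ (i - (k + 1)) = M" "j + 5 - (k + 1) = 0" by (auto simp: i_def)
        then show ?thesis using True M0 by (auto intro!: mult_right_mono)
      next
        case False
        then have e: "j + 5 - (k + 1) = Suc (i - (k + 1))" by (auto simp: i_def)
        have "(real n - 2 * real k + real i) * (M * R ^ (i - (k + 1)))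
            \<le> R * (real n - real i) * (M * R ^ (i - (k + 1)))"
          using False jI M0 R by (intro mult_right_mono step) (auto simp: i_def)
        then show ?thesis unfolding e by (simp add: mult_ac)
      qed
      finally show ?thesis using pos by simp
    qed
    then show ?case using Suc by (simp add: add.commute)
  qed
  then have "j + 3 \<le> I \<Longrightarrow> \<bar>kap n k (j + 3)\<bar> \<le> M * R ^ (j + 3 - (k + 1))" for j by blast
  from this[of "i - 3"] show "3 \<le> i \<Longrightarrow> i \<le> I \<Longrightarrow> \<bar>kap n k i\<bar> \<le> M * R ^ (i - (k + 1))" by simp
qed

lemma abs_diff_le_of_nonneg:
  fixes a b c :: real
  assumes "0 \<le> a" "0 \<le> b" "a \<le> c" "b \<le> c"
  shows "\<bar>a - b\<bar> \<le> c"
  using assms by linarith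

text \<open>Start of the recursion in the argument, with a margin 1 - p/n that later pays for the
  powers of R. Each recursion is a difference of two nonnegative terms, so its absolute value is at
  most the larger one; the hypotheses on n make \<open>kap n p 2\<close> large compared with
  1/n.\<close>

lemma kap_3_4_le:
  fixes d \<delta> :: real
  assumes \<delta>: "0 < \<delta>" and p: "2 \<le> p" and d_def: "d = real n - 2 * real p" and d: "\<delta> * real n \<le> d"
    and n1: "2 \<le> \<delta>\<^sup>2 * real n" and n3: "8 \<le> \<delta>\<^sup>2 * (real n - 2)" and n: "9 \<le> n"
  shows "\<bar>kap n p 3\<bar> \<le> (1 - real p / real n) * kap n p 2"
    "\<bar>kap n p 4\<bar> \<le> (1 - real p / real n) * kap n p 2"
proof -
  define r where "r = 1 - real p / real n"
  have n0: "real n \<ge> 9" using n by simp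
  have d0: "0 < d" using d \<delta> n0 by (smt (verit) mult_pos_pos)
  have pn: "p \<le> n" "2 * real p \<le> real n" using d0 d_def by auto
  have r: "1 / 2 \<le> r" "r \<le> 1" using pn n0 by (auto simp: r_def field_simps)
  have dsq: "d\<^sup>2 / 2 \<le> d\<^sup>2 - real n"
  proof -
    have "(\<delta> * real n)\<^sup>2 \<le> d\<^sup>2" using d \<delta> by (intro power_mono) auto
    moreover have "2 * real n \<le> (\<delta> * real n)\<^sup>2"
      using mult_right_mono[OF n1, of "real n"] by (simp add: power2_eq_square mult_ac)
    ultimately show ?thesis by linarith
  qed
  have k2: "kap n p 2 = (d\<^sup>2 - real n) / (real n * (real n - 1))"
    using kap_at_2[of p n] pn n by (simp add: d_def)
  have k2_ge: "\<delta>\<^sup>2 / 2 \<le> kap n p 2"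
  proof -
    have "\<delta>\<^sup>2 / 2 * (real n * (real n - 1)) \<le> \<delta>\<^sup>2 / 2 * (real n * real n)"
      using n0 by (intro mult_left_mono) auto
    also have "\<dots> = (\<delta> * real n)\<^sup>2 / 2" by (simp add: power2_eq_square)
    also have "\<dots> \<le> d\<^sup>2 / 2" using d \<delta> by (intro divide_right_mono power_mono) auto
    finally have "\<delta>\<^sup>2 / 2 * (real n * (real n - 1)) \<le> d\<^sup>2 - real n" using dsq by linarith
    then show ?thesis unfolding k2 using n0 by (subst pos_le_divide_eq) auto
  qed
  then have k2_pos: "0 < kap n p 2" using \<delta> by (smt (verit) half_gt_zero zero_less_power)
  have k1: "kap n p 1 = d / real n"
    using kap_at_1[of p n] pn n by (simp add: d_def field_simps)
  have dn: "0 \<le> d / real n" "d / real n \<le> 1" using d0 n0 d_def by auto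
  have big: "4 \<le> (real n - 2) * kap n p 2"
  proof -
    have "(real n - 2) * (\<delta>\<^sup>2 / 2) \<le> (real n - 2) * kap n p 2"
      using n0 by (intro mult_left_mono[OF k2_ge]) simp
    moreover have "(real n - 2) * (\<delta>\<^sup>2 / 2) = \<delta>\<^sup>2 * (real n - 2) / 2" by simp
    ultimately show ?thesis using n3 by linarith
  qed
  \<comment> \<open>Expanding the right side gives n - p - 2 + 2p/n, which is at least n - 2p
    because p >= 2.\<close>
  have dr: "d \<le> (real n - 2) * r"
  proof -
    have "(real n - 2) * r = real n - real p - 2 + 2 * real p / real n"
      using n0 by (simp add: r_def field_simps)
    moreover have "0 \<le> 2 * real p / real n" by simp
    moreover have "2 \<le> real p" using p by simp
    ultimately show ?thesis using d_def by linarith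
  qed
  have three: "(real n - 2) * kap n p 3 = d * kap n p 2 - 2 * (d / real n)"
    using kap_three_term[of p n 1] pn n k1 by (simp add: d_def numeral_3_eq_3 numeral_2_eq_2)
  have a3: "\<bar>(real n - 2) * kap n p 3\<bar> \<le> (real n - 2) * (r * kap n p 2)"
    unfolding three
  proof (rule abs_diff_le_of_nonneg)
    show "d * kap n p 2 \<le> (real n - 2) * (r * kap n p 2)"
      using mult_right_mono[OF dr, of "kap n p 2"] k2_pos by (simp add: mult_ac)
    have "2 \<le> 1 / 2 * ((real n - 2) * kap n p 2)" using big by simp
    also have "\<dots> \<le> r * ((real n - 2) * kap n p 2)" using r big by (intro mult_right_mono) auto
    also have "\<dots> = (real n - 2) * (r * kap n p 2)" by simp
    finally show "2 * (d / real n) \<le> (real n - 2) * (r * kap n p 2)"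
      using dn by linarith
  qed (use d0 k2_pos dn in auto)
  then show k3: "\<bar>kap n p 3\<bar> \<le> (1 - real p / real n) * kap n p 2"
    using n0 by (simp add: abs_mult r_def)
  have k3_nonneg: "0 \<le> kap n p 3"
  proof -
    have "2 \<le> real n * kap n p 2" using big k2_pos by (simp add: algebra_simps)
    then have "d / real n * 2 \<le> d / real n * (real n * kap n p 2)" using dn by (intro mult_left_mono) auto
    then have "0 \<le> (real n - 2) * kap n p 3" unfolding three using n0 by (simp add: mult.commute)
    then show ?thesis using n0 by (simp add: zero_le_mult_iff)
  qed
  have four: "(real n - 3) * kap n p 4 = d * kap n p 3 - 3 * kap n p 2"
    using kap_three_term[of p n 2] pn n by (simp add: d_def)
  have "\<bar>(real n - 3) * kap n p 4\<bar> \<le> (real n - 3) * (r * kap n p 2)"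
    unfolding four
  proof (rule abs_diff_le_of_nonneg)
    have "2 \<le> real p" using p by simp
    then have "d \<le> real n - 3" using d_def by linarith
    then have "d * kap n p 3 \<le> (real n - 3) * kap n p 3" using k3_nonneg by (rule mult_right_mono)
    also have "\<dots> \<le> (real n - 3) * (r * kap n p 2)"
      using k3 n0 by (intro mult_left_mono) (auto simp: r_def)
    finally show "d * kap n p 3 \<le> (real n - 3) * (r * kap n p 2)" .
    have "3 \<le> (real n - 3) * (1 / 2)" using n0 by simp
    also have "\<dots> \<le> (real n - 3) * r" using n0 r by (intro mult_left_mono) auto
    finally show "3 * kap n p 2 \<le> (real n - 3) * (r * kap n p 2)"
      using mult_right_mono[of 3 "(real n - 3) * r" "kap n p 2"] k2_pos by (simp add: mult_ac)
  qed (use d0 k3_nonneg k2_pos in auto)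
  then show "\<bar>kap n p 4\<bar> \<le> (1 - real p / real n) * kap n p 2"
    using n0 by (simp add: abs_mult r_def)
qed

text \<open>Here p is the reflected index, below n/2. The recursion in the index covers i >= p + 2 +
  E, and all i >= p + 2 if p < P0; the recursion in the argument covers i <= p + 1 without loss. In
  the remaining gap the latter makes at most E lossy steps, and p >= P0 makes the margin 1 - p/n
  sufficient.\<close>

lemma abs_kap_le_kap_2_lower_half:
  fixes \<delta> :: real
  assumes \<delta>: "0 < \<delta>" and d: "\<delta> * real n \<le> real n - 2 * real p"
    and E: "6 \<le> \<delta> * real E" and P0: "4 * E\<^sup>2 \<le> P0" "2 \<le> P0"
    and n1: "2 \<le> \<delta>\<^sup>2 * real n" and n2: "12 * real P0 \<le> \<delta> * real n"
    and n3: "8 \<le> \<delta>\<^sup>2 * (real n - 2)" and n: "9 \<le> n"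
    and i: "3 \<le> i" "2 * i \<le> n"
  shows "\<bar>kap n p i\<bar> \<le> kap n p 2"
proof -
  have n0: "real n \<ge> 9" using n by simp
  have dn0: "24 \<le> \<delta> * real n" 
  proof -
    have "2 \<le> real P0" using P0(2) by simp
    then show ?thesis using n2 by linarith
  qed
  have pn: "p \<le> n" "2 * p \<le> n" using dn0 d by linarith+
  consider (low) "p + 2 + E \<le> i \<or> p < P0 \<and> p + 2 \<le> i" | (high) "i \<le> p + 1"
    | (gap) "P0 \<le> p" "i \<le> p + 1 + E" by linarith
  then show ?thesis
  proof cases
    case low
    show ?thesis
    proof (rule abs_kap_le_kap_2_of_small_index[where P = p])
      fix k assume kp: "k + 2 \<le> p"
      define q where "q = real k + 1"
      define D where "D = real n - 2 * q"
      have q: "1 \<le> q" "q \<le> real p - 1" using kp by (auto simp: q_def)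
      have D: "\<delta> * real n \<le> D" "24 \<le> D" using d dn0 q by (auto simp: D_def)
      have Dsq: "D\<^sup>2 / 2 \<le> D\<^sup>2 - real n"
      proof -
        have "(\<delta> * real n)\<^sup>2 \<le> D\<^sup>2" using D \<delta> by (intro power_mono) auto
        moreover have "2 * real n \<le> (\<delta> * real n)\<^sup>2"
          using mult_right_mono[OF n1, of "real n"] by (simp add: power2_eq_square mult_ac)
        ultimately show ?thesis by linarith
      qed
      \<comment> \<open>The slack e has to absorb the passage from (D + 2)^2 to D^2, namely q (4D +
        4) <= e (D^2 - n). As 4D + 4 <= 6D and D^2 - n >= D^2/2, the inequality 12q <= e D suffices.
        A large i gives e = E, a small p gives e = 1.\<close>
      have "\<exists>e. q + e \<le> real i - 2 \<and> 0 \<le> e \<and> 12 * q \<le> e * D"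
        using low
      proof
        assume *: "p + 2 + E \<le> i"
        have "q \<le> real n / 2" using q pn by linarith
        then have "12 * q \<le> 6 * real n" by simp
        also have "\<dots> \<le> (\<delta> * real E) * real n" using E by (intro mult_right_mono) auto
        also have "\<dots> = real E * (\<delta> * real n)" by simp
        also have "\<dots> \<le> real E * D" using D by (intro mult_left_mono) auto
        finally have "12 * q \<le> real E * D" .
        moreover have "q + real E \<le> real i - 2" using * q by linarith
        ultimately show ?thesis by (intro exI[of _ "real E"]) auto
      next
        assume *: "p < P0 \<and> p + 2 \<le> i"
        have "12 * q \<le> 12 * real P0" using q * by linarith
        then have "12 * q \<le> 1 * D" using n2 D by linarith
        moreover have "q + 1 \<le> real i - 2" using * q by linarith
        ultimately show ?thesis by (intro exI[of _ 1]) auto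
      qed
      then obtain e where e: "q + e \<le> real i - 2" "0 \<le> e" "12 * q \<le> e * D" by blast
      have "q * (4 * D + 4) \<le> q * (6 * D)" using D q by (intro mult_left_mono) auto
      also have "\<dots> = 12 * q * (D / 2)" by simp
      also have "\<dots> \<le> e * D * (D / 2)" using e D by (intro mult_right_mono) auto
      also have "\<dots> = e * (D\<^sup>2 / 2)" by (simp add: power2_eq_square)
      also have "\<dots> \<le> e * (D\<^sup>2 - real n)" using e Dsq by (intro mult_left_mono) auto
      finally have "q * ((D + 2)\<^sup>2 - real n) \<le> (q + e) * (D\<^sup>2 - real n)"
        by (simp add: power2_eq_square algebra_simps)
      also have "\<dots> \<le> (real i - 2) * (D\<^sup>2 - real n)"
        using e Dsq by (intro mult_right_mono) (auto intro: order_trans[OF _ Dsq])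
      finally have "q * ((D + 2)\<^sup>2 - real n) / (real n * (real n - 1))
          \<le> (real i - 2) * (D\<^sup>2 - real n) / (real n * (real n - 1))"
        using n0 by (intro divide_right_mono) auto
      moreover have "kap n k 2 = ((D + 2)\<^sup>2 - real n) / (real n * (real n - 1))"
        using kap_at_2[of k n] kp pn n by (simp add: D_def q_def)
      moreover have "kap n (k + 1) 2 = (D\<^sup>2 - real n) / (real n * (real n - 1))"
        using kap_at_2[of "k + 1" n] kp pn n by (simp add: D_def q_def)
      ultimately show "(real k + 1) * kap n k 2 \<le> (real i - 2) * kap n (k + 1) 2"
        by (simp add: q_def)
    qed (use i pn in auto)
  next
    case high
    then have p2: "2 \<le> p" using i by simp
    note M = kap_3_4_le[OF \<delta> p2 refl d n1 n3 n]
    have "\<bar>kap n p i\<bar> \<le> (1 - real p / real n) * kap n p 2 * 1 ^ (i - (p + 1))"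
      using high i pn by (intro abs_kap_le_of_large_index[where I = i] M) auto
    also have "\<dots> \<le> kap n p 2"
    proof -
      have "0 \<le> (1 - real p / real n) * kap n p 2" using M(1) by linarith
      moreover have "0 < 1 - real p / real n" using pn n0 by (simp add: field_simps)
      ultimately have "0 \<le> kap n p 2" by (simp add: zero_le_mult_iff)
      moreover have "1 - real p / real n \<le> 1" by simp
      ultimately have "(1 - real p / real n) * kap n p 2 \<le> 1 * kap n p 2" by (intro mult_right_mono)
      then show ?thesis by simp
    qed
    finally show ?thesis .
  next
    case gap
    then have p2: "2 \<le> p" using P0 by simp
    note M = kap_3_4_le[OF \<delta> p2 refl d n1 n3 n]
    \<comment> \<open>In the gap the coefficient sum exceeds n - j by at most 2E, and n - j >=
      n/2.\<close>
    define R where "R = 1 + 4 * real E / real n"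
    have R: "1 \<le> R" by (simp add: R_def)
    have r0: "0 < 1 - real p / real n" using pn n0 by (simp add: field_simps)
    have "0 \<le> (1 - real p / real n) * kap n p 2" using M(1) by linarith
    then have k2: "0 \<le> kap n p 2" using r0 by (simp add: zero_le_mult_iff)
    have "\<bar>kap n p i\<bar> \<le> (1 - real p / real n) * kap n p 2 * R ^ (i - (p + 1))"
    proof (rule abs_kap_le_of_large_index[where I = i])
      fix j assume j: "p < j" "j < i"
      have "real n - 2 * real p + real j \<le> (real n - real j) + 2 * real E" using j gap by linarith
      also have "\<dots> = (real n - real j) + 4 * real E / real n * (real n / 2)" using n0 by simp
      also have "\<dots> \<le> (real n - real j) + 4 * real E / real n * (real n - real j)"
        using j i by (intro add_left_mono mult_left_mono) auto
      finally show "real n - 2 * real p + real j \<le> R * (real n - real j)"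
        by (simp add: R_def distrib_right)
    qed (use M R i pn in auto)
    also have "\<dots> \<le> (1 - real p / real n) * kap n p 2 * R ^ E"
      using r0 k2 R gap by (intro mult_left_mono power_increasing) auto
    also have "\<dots> = ((1 - real p / real n) * R ^ E) * kap n p 2" by simp
    also have "\<dots> \<le> 1 * kap n p 2"
    proof (rule mult_right_mono[OF _ k2])
      \<comment> \<open>By 1 + x <= exp x the exponent becomes (4 E^2 - p)/n, which is why P0 is at
        least 4 E^2.\<close>
      have "(1 - real p / real n) * R ^ E \<le> exp (- (real p / real n)) * exp (4 * real E / real n) ^ E"
        using exp_ge_add_one_self[of "- (real p / real n)"] exp_ge_add_one_self[of "4 * real E / real n"]
          r0 R by (intro mult_mono power_mono) (auto simp: R_def)
      also have "\<dots> = exp (real E * (4 * real E / real n) - real p / real n)"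
        by (simp add: exp_of_nat_mult[symmetric] exp_add[symmetric] mult_exp_exp)
      also have "\<dots> \<le> exp 0"
      proof -
        have "real (4 * E\<^sup>2) \<le> real p" using P0 gap by (subst of_nat_le_iff) auto
        then have "real E * (4 * real E) \<le> real p" by (simp add: power2_eq_square)
        then have "real E * (4 * real E) / real n \<le> real p / real n" by (rule divide_right_mono) simp
        then show ?thesis by simp
      qed
      finally show "(1 - real p / real n) * R ^ E \<le> 1" by simp
    qed
    finally show ?thesis by simp
  qed
qed

lemma eventually_le_linear:
  fixes c e :: real
  assumes "0 < e"
  shows "\<forall>\<^sub>F n in sequentially. c \<le> e * real n"
proof (rule eventually_mono[OF eventually_ge_at_top[of "nat \<lceil>c / e\<rceil>"]])
  fix n assume "nat \<lceil>c / e\<rceil> \<le> n"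
  then have "c / e \<le> real n" by linarith
  then show "c \<le> e * real n" using assms by (simp add: field_simps)
qed

lemma eventually_abs_kap_le_kap_2:
  fixes \<delta> :: real
  assumes \<delta>: "0 < \<delta>"
  shows "\<forall>\<^sub>F n in sequentially. \<forall>k i. k \<le> n \<longrightarrow> \<delta> * real n \<le> 2 * real k - real n \<longrightarrow> 2 \<le> i \<longrightarrow> i + 2 \<le> n
    \<longrightarrow> \<bar>kap n k i\<bar> \<le> kap n k 2"
proof -
  \<comment> \<open>Both E and P0 depend on \<delta> alone, so every size condition holds for large
    n. Reflecting k to n - k and, if needed, i to n - i leads to the lower half; the value at 2 is
    unchanged because 2 is even.\<close>
  define E where "E = nat \<lceil>6 / \<delta>\<rceil>"
  define P0 where "P0 = max 2 (4 * E\<^sup>2)"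
  have "6 / \<delta> \<le> real E" unfolding E_def by linarith
  then have E: "6 \<le> \<delta> * real E" using \<delta> by (simp add: field_simps)
  have s: "0 < \<delta>\<^sup>2" using \<delta> by simp
  show ?thesis
    using eventually_le_linear[OF s, of 2] eventually_le_linear[OF \<delta>, of "12 * real P0"] eventually_le_linear[OF s, of "8 + 2 * \<delta>\<^sup>2"] eventually_ge_at_top[of 9]
  proof eventually_elim
    case (elim n)
    show ?case
    proof (intro allI impI)
      fix k i assume *: "k \<le> n" "\<delta> * real n \<le> 2 * real k - real n" "2 \<le> i" "i + 2 \<le> n"
      define p where "p = n - k"
      have half: "\<bar>kap n p j\<bar> \<le> kap n p 2" if "3 \<le> j" "2 * j \<le> n" for j
        using that elim * \<delta> E
        by (intro abs_kap_le_kap_2_lower_half[of \<delta> n p E P0])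
          (auto simp: p_def P0_def of_nat_diff algebra_simps)
      have pn: "p \<le> n" by (simp add: p_def)
      have two: "\<bar>kap n p 2\<bar> = kap n p 2"
        using half[of 3] elim by auto
      have "\<bar>kap n p i\<bar> \<le> kap n p 2"
      proof (cases "2 * i \<le> n")
        case True
        then show ?thesis using half[of i] two * by (cases "i = 2") auto
      next
        case False
        have "\<bar>kap n p (n - i)\<bar> \<le> kap n p 2"
          using half[of "n - i"] two * False by (cases "n - i = 2") auto
        then show ?thesis using abs_kap_reflect[of i n p] * by simp
      qed
      then show "\<bar>kap n k i\<bar> \<le> kap n k 2"
        using kap_reflect_left[of k n 2] abs_kap_reflect_left[of k n i] * by (simp add: p_def)
    qed
  qed
qed

section \<open>Feasible points of the linear program\<close>

text \<open>The sum over k telescopes by the recursion that raises n and x together.\<close>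

lemma omega_Suc_Suc: "omega (Suc m) r (Suc j) = krawtchouk m r (real j)"
proof (induction r)
  case (Suc r)
  then show ?case
    using krawtchouk_Suc_Suc_add_1[of m r "real j"] by (simp add: omega_def add.commute)
qed (simp add: omega_def)

lemma omega_gap_eq:
  assumes "1 \<le> i" "i \<le> n" "r < n"
  shows "omega n r 1 - omega n r i = real ((n - 1) choose r) * (1 - kap (n - 1) r (i - 1))"
proof -
  obtain m j where "n = Suc m" "i = Suc j" using assms by (cases n; cases i) auto
  then show ?thesis
    using assms omega_Suc_Suc[of m r 0] by (simp add: omega_Suc_Suc krawtchouk_eq_kap right_diff_distrib)
qed

lemma omega_eq_0:
  assumes "1 \<le> i" "i \<le> n" "n \<le> r"
  shows "omega n r i = 0"
proof -
  obtain m j where "n = Suc m" "i = Suc j" using assms by (cases n; cases i) auto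
  then show ?thesis using assms by (simp add: omega_Suc_Suc krawtchouk_eq_0)
qed

lemma omega_gap_nonneg:
  assumes "1 \<le> i" "i \<le> n"
  shows "0 \<le> omega n r 1 - omega n r i"
proof (cases "r < n")
  case True
  have "i - 1 \<le> n - 1" "r \<le> n - 1" using assms True by auto
  then have "\<bar>kap (n - 1) r (i - 1)\<bar> \<le> 1" by (rule abs_kap_le_1)
  then have "kap (n - 1) r (i - 1) \<le> 1" by linarith
  then show ?thesis unfolding omega_gap_eq[OF assms True] by simp
next
  case False
  then show ?thesis using assms by (simp add: omega_eq_0)
qed

text \<open>Constraints and objective see a point only through its transform S, so each construction
  just has to compute S.\<close>

lemma Lambda_bar_geI:
  assumes x: "\<And>j. 1 \<le> j \<Longrightarrow> j \<le> n \<Longrightarrow> 0 \<le> x j" and n: "1 \<le> n"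
    and S: "\<And>i. i \<le> n \<Longrightarrow> (\<Sum>j=1..n. krawtchouk n j (real i) * x j) = S i"
    and le: "\<And>i. 2 \<le> i \<Longrightarrow> i \<le> n \<Longrightarrow> S i - S 1 \<le> omega n r 1 - omega n r i"
  shows "ereal (- S 0 - S 1 * (1 / \<alpha> - 1)) \<le> Lambda_bar n \<alpha> r"
proof -
  have "x \<in> lp_feasible n r"
    using x n S[of 1] S le by (fastforce simp: lp_feasible_def left_diff_distrib sum_subtractf)
  moreover have "lp_objective n \<alpha> x = - S 0 - S 1 * (1 / \<alpha> - 1)"
  proof -
    have "lp_objective n \<alpha> x = - (\<Sum>j=1..n. krawtchouk n j (real 0) * x j)
        - (\<Sum>j=1..n. krawtchouk n j (real 1) * x j) * (1 / \<alpha> - 1)"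
      unfolding lp_objective_def sum_distrib_right
      by (simp add: algebra_simps sum.distrib sum_subtractf)
    then show ?thesis using S[of 0] S[of 1] n by simp
  qed
  ultimately show ?thesis unfolding Lambda_bar_def by (metis SUP_upper)
qed

text \<open>The zero point is feasible. This also disposes of every claimed lower bound that is not
  positive.\<close>

lemma Lambda_bar_nonneg: "0 \<le> Lambda_bar n \<alpha> r"
proof -
  have "(\<lambda>_. 0) \<in> lp_feasible n r" using omega_gap_nonneg[of _ n r] by (auto simp: lp_feasible_def)
  then have "ereal (lp_objective n \<alpha> (\<lambda>_. 0)) \<le> Lambda_bar n \<alpha> r"
    unfolding Lambda_bar_def by (rule SUP_upper)
  then show ?thesis by (simp add: lp_objective_def zero_ereal_def)
qed

lemma Lambda_bar_ge_single:
  assumes k: "1 \<le> k" "k \<le> n" and X: "0 \<le> X"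
    and le: "\<And>i. 2 \<le> i \<Longrightarrow> i \<le> n \<Longrightarrow>
      X * (kap n k i + (2 * real k / real n - 1)) \<le> omega n r 1 - omega n r i"
  shows "ereal (X * ((2 * real k / real n - 1) * (1 / \<alpha> - 1) - 1)) \<le> Lambda_bar n \<alpha> r"
proof -
  define x where "x j = (if j = k then X / real (n choose k) else 0)" for j
  have e: "2 * real k / real n - 1 = - kap n k 1" using kap_at_1[of k n] k by simp
  have "ereal (- (X * kap n k 0) - (X * kap n k 1) * (1 / \<alpha> - 1)) \<le> Lambda_bar n \<alpha> r"
  proof (rule Lambda_bar_geI[where x = x])
    show "(\<Sum>j=1..n. krawtchouk n j (real i) * x j) = X * kap n k i" for i
      using k by (simp add: x_def if_distrib[of "\<lambda>t. _ * t"] sum.delta kap_def cong: if_cong)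
    show "X * kap n k i - X * kap n k 1 \<le> omega n r 1 - omega n r i" if "2 \<le> i" "i \<le> n" for i
      using le[OF that] unfolding e by (simp add: algebra_simps)
  qed (use k X in \<open>auto simp: x_def\<close>)
  then show ?thesis unfolding e using k by (simp add: algebra_simps)
qed

text \<open>Equal weights on k and k + 1 merge into one Krawtchouk polynomial of length n + 1 and
  index k + 1.\<close>

lemma Lambda_bar_ge_double:
  assumes k: "1 \<le> k" "k \<le> n" and X: "0 \<le> X"
    and le: "\<And>i. 2 \<le> i \<Longrightarrow> i \<le> n \<Longrightarrow>
      X * (kap (n + 1) (k + 1) i + (2 * real (k + 1) / real (n + 1) - 1)) \<le> omega n r 1 - omega n r i"
  shows "ereal (X * ((2 * real (k + 1) / real (n + 1) - 1) * (1 / \<alpha> - 1) - 1)) \<le> Lambda_bar n \<alpha> r"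
proof -
  define c where "c = X / real ((n + 1) choose (k + 1))"
  define x where "x j = (if j \<in> {k, k + 1} then c else 0)" for j
  have c: "0 \<le> c" using X by (simp add: c_def)
  have e: "2 * real (k + 1) / real (n + 1) - 1 = - kap (n + 1) (k + 1) 1"
    using kap_at_1[of "k + 1" "n + 1"] k by simp
  have "ereal (- (X * kap (n + 1) (k + 1) 0) - (X * kap (n + 1) (k + 1) 1) * (1 / \<alpha> - 1)) \<le> Lambda_bar n \<alpha> r"
  proof (rule Lambda_bar_geI[where x = x])
    show "(\<Sum>j=1..n. krawtchouk n j (real i) * x j) = X * kap (n + 1) (k + 1) i" if i: "i \<le> n" for i
    proof -
      \<comment> \<open>For k = n the index k + 1 lies outside the program, but its Krawtchouk
        polynomial vanishes at all i <= n, so the sum may be extended.\<close>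
      have "(\<Sum>j=1..n. krawtchouk n j (real i) * x j)
          = (\<Sum>j\<in>{1..n + 1}. krawtchouk n j (real i) * x j)"
        using krawtchouk_eq_0[OF i, of "n + 1"] by simp
      also have "\<dots> = (\<Sum>j\<in>{k, k + 1}. krawtchouk n j (real i) * x j)"
        using k by (intro sum.mono_neutral_right) (auto simp: x_def)
      also have "\<dots> = c * krawtchouk (n + 1) (k + 1) (real i)"
        using krawtchouk_Suc_Suc[of n k "real i"] by (simp add: x_def algebra_simps)
      finally show ?thesis by (simp add: c_def kap_def)
    qed
    show "X * kap (n + 1) (k + 1) i - X * kap (n + 1) (k + 1) 1 \<le> omega n r 1 - omega n r i"
      if "2 \<le> i" "i \<le> n" for i
      using le[OF that] unfolding e by (simp add: algebra_simps)
  qed (use k c in \<open>auto simp: x_def\<close>)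
  then show ?thesis unfolding e using k by (simp add: algebra_simps)
qed

text \<open>The sum of all Krawtchouk polynomials vanishes at i >= 1, so the transform of the
  indicator of \<open>{s<..n}\<close> is minus \<open>omega n s\<close> there. The constraints then
  compare two differences of the same form, for s and for r.\<close>

lemma Lambda_bar_ge_tail:
  assumes s: "s < n" and c: "0 \<le> c"
    and le: "\<And>i. 2 \<le> i \<Longrightarrow> i \<le> n \<Longrightarrow> c * (omega n s 1 - omega n s i) \<le> omega n r 1 - omega n r i"
  shows "ereal (c * (real ((n - 1) choose s) * (1 / \<alpha> - 1) - (\<Sum>j=Suc s..n. real (n choose j))))
    \<le> Lambda_bar n \<alpha> r"
proof -
  define x where "x j = (if s < j then c else 0)" for j
  define S where "S i = c * (\<Sum>j=Suc s..n. krawtchouk n j (real i))" for i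
  have S: "(\<Sum>j=1..n. krawtchouk n j (real i) * x j) = S i" for i
  proof -
    have "(\<Sum>j=1..n. krawtchouk n j (real i) * x j) = (\<Sum>j=Suc s..n. krawtchouk n j (real i) * x j)"
      by (intro sum.mono_neutral_right) (auto simp: x_def)
    also have "\<dots> = (\<Sum>j=Suc s..n. c * krawtchouk n j (real i))"
      by (intro sum.cong) (auto simp: x_def)
    finally show ?thesis by (simp add: S_def sum_distrib_left)
  qed
  have S': "S i = - (c * omega n s i)" if i: "1 \<le> i" "i \<le> n" for i
  proof -
    have "omega n n i = omega n s i + (\<Sum>j=Suc s..n. krawtchouk n j (real i))"
      unfolding omega_def using s
      by (metis Suc_eq_plus1 le_add_diff_inverse less_imp_le_nat sum.ub_add_nat zero_le)
    then have "(\<Sum>j=Suc s..n. krawtchouk n j (real i)) = - omega n s i"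
      using omega_eq_0[OF i order_refl] by simp
    then show ?thesis by (simp add: S_def)
  qed
  have "ereal (- S 0 - S 1 * (1 / \<alpha> - 1)) \<le> Lambda_bar n \<alpha> r"
  proof (rule Lambda_bar_geI[where x = x])
    show "S i - S 1 \<le> omega n r 1 - omega n r i" if "2 \<le> i" "i \<le> n" for i
      using le[OF that] S'[of i] S'[of 1] that by (simp add: algebra_simps)
  qed (use S s c in \<open>auto simp: x_def\<close>)
  moreover have "S 0 = c * (\<Sum>j=Suc s..n. real (n choose j))" by (simp add: S_def)
  moreover have "omega n s 1 = real ((n - 1) choose s)"
    using omega_Suc_Suc[of "n - 1" s 0] s by simp
  ultimately show ?thesis using S'[of 1] s by (simp add: algebra_simps)
qed

text \<open>The index i = n is left out because the right-hand side is zero there when r is even.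
  With the factor 2, B becomes the binomial coefficient in front of the final bounds.\<close>

definition gap_ge :: "nat \<Rightarrow> nat \<Rightarrow> real \<Rightarrow> bool" where
  "gap_ge n r B \<longleftrightarrow> 0 \<le> B \<and> (\<forall>i. 2 \<le> i \<longrightarrow> i < n \<longrightarrow> 2 * B \<le> omega n r 1 - omega n r i)"

lemma binomial_absorb_real:
  assumes "1 \<le> m"
  shows "r \<le> m \<Longrightarrow> real m * real ((m - 1) choose r) = (real m - real r) * real (m choose r)"
    "1 \<le> r \<Longrightarrow> real m * real ((m - 1) choose (r - 1)) = real r * real (m choose r)"
proof -
  obtain l where l: "m = Suc l" using assms by (cases m) auto
  have 2: "real m * real ((m - 1) choose (r - 1)) = real r * real (m choose r)" if "1 \<le> r" for r
  proof -
    obtain t where "r = Suc t" using \<open>1 \<le> r\<close> by (cases r) auto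
    then show ?thesis
      using Suc_times_binomial_eq[of l t] l by (metis diff_Suc_1 mult.commute of_nat_mult)
  qed
  show "1 \<le> r \<Longrightarrow> real m * real ((m - 1) choose (r - 1)) = real r * real (m choose r)" by (rule 2)
  show "real m * real ((m - 1) choose r) = (real m - real r) * real (m choose r)" if "r \<le> m"
  proof (cases r)
    case (Suc t)
    have "real (m choose r) = real (l choose t) + real (l choose r)" by (simp add: l Suc)
    then show ?thesis using 2[of r] by (simp add: l Suc algebra_simps)
  qed simp
qed

lemma gap_ge_low:
  assumes "1 \<le> r" "2 * r + 2 \<le> n"
  shows "gap_ge n r (real ((n - 2) choose (r - 1)))"
  unfolding gap_ge_def
proof (intro conjI allI impI)
  fix i assume i: "2 \<le> i" "i < n"
  define m where "m = n - 1"
  have m: "n - 2 = m - 1" "real m > 0" using assms by (auto simp: m_def)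
  have "\<bar>kap m r (i - 1)\<bar> \<le> 1 - 2 * real r / real m"
    using assms i by (intro abs_kap_le) (auto simp: m_def)
  then have "2 * real r / real m \<le> 1 - kap m r (i - 1)" by linarith
  then have "real (m choose r) * (2 * real r / real m) \<le> real (m choose r) * (1 - kap m r (i - 1))"
    by (intro mult_left_mono) auto
  moreover have "real (m choose r) * (2 * real r / real m) = 2 * real ((n - 2) choose (r - 1))"
    using binomial_absorb_real(2)[of m r] assms m by (simp add: field_simps)
  ultimately show "2 * real ((n - 2) choose (r - 1)) \<le> omega n r 1 - omega n r i"
    using omega_gap_eq[of i n r] i assms by (simp add: m_def)
qed simp

lemma gap_ge_high:
  assumes "n \<le> 2 * r"
  shows "gap_ge n r (real ((n - 2) choose r))"
  unfolding gap_ge_def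
proof (intro conjI allI impI)
  fix i assume i: "2 \<le> i" "i < n"
  define m where "m = n - 1"
  have m: "n - 2 = m - 1" "real m > 0" using i by (auto simp: m_def)
  show "2 * real ((n - 2) choose r) \<le> omega n r 1 - omega n r i"
  proof (cases "r < n")
    case True
    have "\<bar>kap m r (i - 1)\<bar> \<le> 2 * real r / real m - 1"
      using assms i True by (intro abs_kap_le') (auto simp: m_def)
    then have "2 - 2 * real r / real m \<le> 1 - kap m r (i - 1)" by linarith
    then have "real (m choose r) * (2 - 2 * real r / real m) \<le> real (m choose r) * (1 - kap m r (i - 1))"
      by (intro mult_left_mono) auto
    moreover have "real (m choose r) * (2 - 2 * real r / real m) = 2 * real ((n - 2) choose r)"
    proof -
      have "real m * real ((m - 1) choose r) = (real m - real r) * real (m choose r)"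
        using True m by (intro binomial_absorb_real(1)) (auto simp: m_def)
      then show ?thesis using m by (simp add: field_simps)
    qed
    ultimately show ?thesis using omega_gap_eq[of i n r] i True by (simp add: m_def)
  next
    case False
    then have z: "(n - 2) choose r = 0" using i by (intro binomial_eq_0) auto
    show ?thesis unfolding z using omega_gap_nonneg[of i n r] i by simp
  qed
qed simp

text \<open>For n <= 2r the coefficient at r + 1 is at most that at r. For n = 2r + 1 the index r is
  the middle one of length n - 1; there the ratio (r - 1)/(r + 1) of the two coefficients makes up
  for the error 1/(2r - 1).\<close>

lemma gap_ge_high_Suc:
  assumes "n \<le> 2 * r + 1"
  shows "gap_ge n r (real ((n - 2) choose (r + 1)))"
proof -
  have step: "real (Suc r) * real ((n - 2) choose Suc r) = (real (n - 2) - real r) * real ((n - 2) choose r)"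
    by (rule Suc_times_binomial_real)
  show ?thesis
  proof (cases "n \<le> 2 * r")
    case True
    have "real (Suc r) * real ((n - 2) choose Suc r) \<le> real (Suc r) * real ((n - 2) choose r)"
      unfolding step using True by (intro mult_right_mono) auto
    then have "real ((n - 2) choose (r + 1)) \<le> real ((n - 2) choose r)" by simp
    then show ?thesis using gap_ge_high[OF True] unfolding gap_ge_def by fastforce
  next
    case False
    then have n: "n = 2 * r + 1" using assms by simp
    show ?thesis
      unfolding gap_ge_def
    proof (intro conjI allI impI)
      fix i assume i: "2 \<le> i" "i < n"
      have r: "1 \<le> r" using i n by simp
      define b where "b = real ((2 * r - 1) choose r)"
      have b: "real ((2 * r) choose r) = 2 * b"
        using binomial_absorb_real(1)[of "2 * r" r] r by (simp add: b_def algebra_simps)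
      have "(real r + 1) * real ((n - 2) choose (r + 1)) = (real r - 1) * b"
        using step r by (simp add: n b_def of_nat_diff add.commute)
      then have "real ((n - 2) choose (r + 1)) = (real r - 1) / (real r + 1) * b"
        by (simp add: field_simps)
      also have "\<dots> \<le> (1 - 1 / (2 * real r - 1)) * b"
      proof (rule mult_right_mono)
        have "1 / (2 * real r - 1) \<le> 2 / (real r + 1)" using r by (simp add: field_simps)
        moreover have "(real r - 1) / (real r + 1) = 1 - 2 / (real r + 1)" by (simp add: field_simps)
        ultimately show "(real r - 1) / (real r + 1) \<le> 1 - 1 / (2 * real r - 1)" by linarith
      qed (simp add: b_def)
      also have "\<dots> \<le> (1 - kap (2 * r) r (i - 1)) * b"
      proof (rule mult_right_mono)
        have "\<bar>kap (2 * r) r (i - 1)\<bar> \<le> 1 / (2 * real r - 1)"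
          using i n by (intro abs_kap_middle_le) auto
        then show "1 - 1 / (2 * real r - 1) \<le> 1 - kap (2 * r) r (i - 1)" by linarith
      qed (simp add: b_def)
      finally have "real ((n - 2) choose (r + 1)) \<le> (1 - kap (2 * r) r (i - 1)) * b" .
      moreover have "omega n r 1 - omega n r i = 2 * ((1 - kap (2 * r) r (i - 1)) * b)"
      proof -
        have "omega n r 1 - omega n r i = real ((2 * r) choose r) * (1 - kap (2 * r) r (i - 1))"
          using omega_gap_eq[of i n r] i r n by simp
        then show ?thesis unfolding b by (simp only: mult_ac)
      qed
      ultimately show "2 * real ((n - 2) choose (r + 1)) \<le> omega n r 1 - omega n r i" by linarith
    qed simp
  qed
qed

section \<open>Binomial tails and points supported on an upper range\<close>

lemma ereal_le_Lambda_bar_scaled: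
  assumes "ereal (B * t * v) \<le> Lambda_bar n \<alpha> r" "0 \<le> B" "0 \<le> u" "u \<le> t"
  shows "ereal (B * u * v) \<le> Lambda_bar n \<alpha> r"
proof (cases "0 \<le> v")
  case True
  then have "B * u * v \<le> B * t * v" using assms by (intro mult_right_mono mult_left_mono)
  then show ?thesis using assms(1) by (meson ereal_less_eq(3) order_trans)
next
  case False
  then have "B * u * v \<le> 0" using assms by (simp add: mult_nonneg_nonpos)
  then show ?thesis using Lambda_bar_nonneg[of n \<alpha> r] by (metis ereal_less_eq(3) order_trans zero_ereal_def)
qed

text \<open>The sum telescopes: (n - k) C(n,k) = (k + 1) C(n,k+1) makes each summand a difference of
  consecutive right sides.\<close>

lemma sum_binomial_weighted:
  "k \<le> n \<Longrightarrow> (\<Sum>j=k..n. (2 * real j - real n) * real (n choose j)) = real k * real (n choose k)"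
proof (induction k rule: inc_induct)
  case base
  then show ?case by simp
next
  case (step k)
  have "(\<Sum>j=k..n. (2 * real j - real n) * real (n choose j)) =
      (2 * real k - real n) * real (n choose k) + real (Suc k) * real (n choose Suc k)"
    using step by (simp add: sum.atLeast_Suc_atMost[of k n])
  then show ?case unfolding Suc_times_binomial_real by (simp add: algebra_simps)
qed

lemma sum_binomial_tail_le:
  assumes "n < 2 * k" "k \<le> n"
  shows "(\<Sum>j=k..n. real (n choose j)) \<le> real n / (2 * real k - real n) * real ((n - 1) choose (k - 1))"
proof -
  have "(2 * real k - real n) * (\<Sum>j=k..n. real (n choose j))
      \<le> (\<Sum>j=k..n. (2 * real j - real n) * real (n choose j))"
    unfolding sum_distrib_left by (intro sum_mono mult_right_mono) auto
  also have "\<dots> = real n * real ((n - 1) choose (k - 1))"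
    using sum_binomial_weighted[OF assms(2)] binomial_absorb_real(2)[of n k] assms by simp
  finally show ?thesis using assms by (simp add: field_simps)
qed

text \<open>The point is c times the indicator of \<open>{k..n}\<close>. Since k is odd, s = k - 1
  is even and the left side vanishes at i = n; elsewhere \<open>abs_kap_le'\<close> bounds it by 2B.
  The free u allows n/k in place of (n - 1)/(k - 1).\<close>

lemma Lambda_bar_ge_scaled_tail:
  assumes k: "odd k" "n + 1 < 2 * k" "k \<le> n" and B: "gap_ge n r B"
    and u: "0 \<le> u" "u \<le> (real n - 1) / (real k - 1)"
  shows "ereal (B * u * (1 / \<alpha> - 1 - real n / (2 * real k - real n))) \<le> Lambda_bar n \<alpha> r"
proof -
  define s where "s = k - 1"
  define m where "m = n - 1"
  \<comment> \<open>By absorption the uniform bound for the differences of \<open>omega n s\<close>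
    is twice this denominator, so c scales it to exactly 2B.\<close>
  define c where "c = B / real ((m - 1) choose (s - 1))"
  have B0: "0 \<le> B" using B by (simp add: gap_ge_def)
  have k3: "3 \<le> k" using k by presburger
  have s: "even s" "m < 2 * s" "s \<le> m" "2 \<le> s" "k = Suc s" "n = Suc m" "1 \<le> m"
    using k k3 by (auto simp: s_def m_def)
  have pos: "real ((m - 1) choose (s - 1)) > 0" "real (m choose s) > 0" using s by auto
  have c0: "0 \<le> c" using B0 by (simp add: c_def)
  have absorb: "real m * real ((m - 1) choose (s - 1)) = real s * real (m choose s)"
    using s by (intro binomial_absorb_real(2)) auto
  have cm: "c * real (m choose s) = B * (real m / real s)"
  proof -
    have "real (m choose s) = real m * real ((m - 1) choose (s - 1)) / real s"
      using absorb s by (simp add: field_simps)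
    then show ?thesis using pos by (simp add: c_def)
  qed
  have "ereal (c * (real ((n - 1) choose s) * (1 / \<alpha> - 1) - (\<Sum>j=Suc s..n. real (n choose j))))
    \<le> Lambda_bar n \<alpha> r"
  proof (rule Lambda_bar_ge_tail)
    fix i assume i: "2 \<le> i" "i \<le> n"
    have eq: "c * (omega n s 1 - omega n s i) = B * (real m / real s) * (1 - kap m s (i - 1))"
    proof -
      have "omega n s 1 - omega n s i = real (m choose s) * (1 - kap m s (i - 1))"
        unfolding m_def using i s by (intro omega_gap_eq) auto
      then show ?thesis unfolding cm[symmetric] by (simp only: mult.assoc)
    qed
    show "c * (omega n s 1 - omega n s i) \<le> omega n r 1 - omega n r i"
    proof (cases "i = n")
      case True
      then have "kap m s (i - 1) = 1" using kap_at_top[of s m] s by simp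
      then show ?thesis unfolding eq using omega_gap_nonneg[of i n r] i by simp
    next
      case False
      have "\<bar>kap m s (i - 1)\<bar> \<le> 2 * real s / real m - 1"
        using s i False by (intro abs_kap_le') auto
      then have "1 - kap m s (i - 1) \<le> 2 * real s / real m" by linarith
      then have "B * (real m / real s) * (1 - kap m s (i - 1)) \<le> B * (real m / real s) * (2 * real s / real m)"
        using B0 by (intro mult_left_mono) auto
      also have "\<dots> = 2 * B" using s by (simp add: field_simps)
      also have "\<dots> \<le> omega n r 1 - omega n r i" using B i False by (simp add: gap_ge_def)
      finally show ?thesis unfolding eq .
    qed
  qed (use s c0 in auto)
  moreover have "B * (real m / real s) * (1 / \<alpha> - 1 - real n / (2 * real k - real n)) \<le>
      c * (real ((n - 1) choose s) * (1 / \<alpha> - 1) - (\<Sum>j=Suc s..n. real (n choose j)))"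
  proof -
    have "(\<Sum>j=Suc s..n. real (n choose j)) \<le> real n / (2 * real k - real n) * real (m choose s)"
      using sum_binomial_tail_le[of n k] k s by simp
    then have "c * (\<Sum>j=Suc s..n. real (n choose j)) \<le> c * (real n / (2 * real k - real n) * real (m choose s))"
      using c0 by (rule mult_left_mono)
    also have "\<dots> = B * (real m / real s) * (real n / (2 * real k - real n))"
      unfolding cm[symmetric] by simp
    finally have "c * (\<Sum>j=Suc s..n. real (n choose j)) \<le> B * (real m / real s) * (real n / (2 * real k - real n))" .
    moreover have "c * (real (m choose s) * (1 / \<alpha> - 1)) = B * (real m / real s) * (1 / \<alpha> - 1)"
      unfolding cm[symmetric] by simp
    ultimately show ?thesis by (simp add: m_def right_diff_distrib)
  qed
  ultimately have *: "ereal (B * (real m / real s) * (1 / \<alpha> - 1 - real n / (2 * real k - real n))) \<le> Lambda_bar n \<alpha> r"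
    by (meson ereal_less_eq(3) order_trans)
  have "real m / real s = (real n - 1) / (real k - 1)" using s by simp
  then have "u \<le> real m / real s" using u(2) by simp
  from ereal_le_Lambda_bar_scaled[OF * B0 u(1) this] show ?thesis .
qed

section \<open>Lower bounds of the form \<open>\<psi>\<close>\<close>

text \<open>The mass X = nB/(2k - n) makes the left sides equal to B times a quantity of the form 1
  + t. Oddness of k gives \<open>kap n k n = -1\<close>, so the constraint at i = n has a
  nonpositive left side.\<close>

lemma Lambda_bar_ge_single_scaled:
  assumes k: "odd k" "n + 2 \<le> 2 * k" "k \<le> n" and B: "0 \<le> B"
    and le: "\<And>i. 2 \<le> i \<Longrightarrow> i < n \<Longrightarrow>
      B * (1 + kap n k i * (real n / (2 * real k - real n))) \<le> omega n r 1 - omega n r i"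
  shows "ereal (real k * B / (2 * real k - real n) * (2 * (1 / \<alpha> - 1) - 1 / \<alpha> * (real n / real k)))
    \<le> Lambda_bar n \<alpha> r"
proof -
  define d where "d = 2 * real k - real n"
  define X where "X = real n / d * B"
  define a where "a = 1 / \<alpha>"
  have d: "d > 0" and n: "real n > 0" and k0: "real k > 0" using k by (auto simp: d_def)
  have X: "0 \<le> X" using B d by (simp add: X_def)
  have scale: "X * (t + (2 * real k / real n - 1)) = B * (1 + t * (real n / d))" for t
    using d n by (simp add: X_def d_def field_simps)
  have "ereal (X * ((2 * real k / real n - 1) * (a - 1) - 1)) \<le> Lambda_bar n \<alpha> r"
    unfolding a_def
  proof (rule Lambda_bar_ge_single)
    fix i assume i: "2 \<le> i" "i \<le> n"
    show "X * (kap n k i + (2 * real k / real n - 1)) \<le> omega n r 1 - omega n r i"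
    proof (cases "i = n")
      case True
      have "kap n k i = -1" using kap_at_top[of k n] k True by simp
      moreover have "2 * real k / real n - 1 \<le> 1" using k n by (simp add: divide_le_eq)
      ultimately have "X * (kap n k i + (2 * real k / real n - 1)) \<le> 0"
        using X by (simp add: mult_le_0_iff)
      then show ?thesis using omega_gap_nonneg[of i n r] i by simp
    next
      case False
      then show ?thesis unfolding scale using le[of i] i by (simp add: d_def)
    qed
  qed (use k X in auto)
  moreover have "X * ((2 * real k / real n - 1) * (a - 1) - 1)
      = real k * B / d * (2 * (a - 1) - a * (real n / real k))"
  proof -
    have "real n * ((2 * real k / real n - 1) * (a - 1) - 1) = (2 * real k - real n) * (a - 1) - real n"
      using n by (simp add: field_simps)
    moreover have "X = B / d * real n" by (simp add: X_def)
    ultimately have "X * ((2 * real k / real n - 1) * (a - 1) - 1) = B / d * ((2 * real k - real n) * (a - 1) - real n)"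
      by (simp only: mult.assoc)
    also have "(2 * real k - real n) * (a - 1) - real n = real k * (2 * (a - 1) - a * (real n / real k))"
      using k0 by (simp add: field_simps)
    finally show ?thesis by simp
  qed
  ultimately show ?thesis by (simp add: a_def d_def)
qed

lemma abs_kap_scaled_le:
  assumes k: "n + 2 \<le> 2 * k" "k \<le> n" and i: "1 \<le> i" "i < n"
  shows "\<bar>kap n k i * (real n / (2 * real k - real n))\<bar> \<le> 1"
proof -
  have d: "2 * real k - real n > 0" "real n > 0" using k by auto
  have "\<bar>kap n k i\<bar> * (real n / (2 * real k - real n))
      \<le> (2 * real k / real n - 1) * (real n / (2 * real k - real n))"
    using k i d by (intro mult_right_mono abs_kap_le') auto
  also have "\<dots> = 1" using d by (simp add: field_simps)
  finally show ?thesis using d by (simp add: abs_mult)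
qed

lemma Lambda_bar_ge_single_of_gap:
  assumes k: "odd k" "n + 2 \<le> 2 * k" "k \<le> n" and B: "gap_ge n r B"
  shows "ereal (real k * B / (2 * real k - real n) * (2 * (1 / \<alpha> - 1) - 1 / \<alpha> * (real n / real k)))
    \<le> Lambda_bar n \<alpha> r"
proof (rule Lambda_bar_ge_single_scaled[OF k])
  show B0: "0 \<le> B" using B by (simp add: gap_ge_def)
  fix i assume i: "2 \<le> i" "i < n"
  have "\<bar>kap n k i * (real n / (2 * real k - real n))\<bar> \<le> 1"
    using k i by (intro abs_kap_scaled_le) auto
  then have "1 + kap n k i * (real n / (2 * real k - real n)) \<le> 2" by linarith
  then have "B * (1 + kap n k i * (real n / (2 * real k - real n))) \<le> B * 2"
    using B0 by (rule mult_left_mono)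
  also have "\<dots> \<le> omega n r 1 - omega n r i" using B i by (simp add: gap_ge_def mult.commute)
  finally show "B * (1 + kap n k i * (real n / (2 * real k - real n))) \<le> omega n r 1 - omega n r i" .
qed

text \<open>For \<open>n = 2r + 1\<close> the uniform lower bound on the right-hand sides is too weak; here the
  constraints are compared index by index.\<close>

lemma Lambda_bar_ge_single_middle:
  assumes k: "odd k" "n + 2 \<le> 2 * k" "k \<le> n" and r: "odd r" "n = 2 * r + 1" and n: "7 \<le> n"
  shows "ereal (real k * real ((n - 2) choose r) / (2 * real k - real n)
    * (2 * (1 / \<alpha> - 1) - 1 / \<alpha> * (real n / real k))) \<le> Lambda_bar n \<alpha> r"
proof (rule Lambda_bar_ge_single_scaled[OF k])
  define B where "B = real ((n - 2) choose r)"
  define d where "d = 2 * real k - real n"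
  show "0 \<le> real ((n - 2) choose r)" by simp
  fix i assume i: "2 \<le> i" "i < n"
  define t where "t = kap n k i * (real n / d)"
  define v where "v = kap (2 * r) r (i - 1)"
  have d: "d \<ge> 2" "real n \<ge> 7" using k n by (auto simp: d_def)
  have n2: "2 * real r - 1 = real n - 2" using r by simp
  have t1: "\<bar>t\<bar> \<le> 1" unfolding t_def d_def using k i by (intro abs_kap_scaled_le) auto
  have v1: "\<bar>v\<bar> \<le> 1 / (real n - 2)"
    unfolding v_def n2[symmetric] using i r by (intro abs_kap_middle_le) auto
  have v2: "v \<le> 1 / (real n - 2)" using v1 by (simp add: abs_le_iff)
  \<comment> \<open>This is the constraint divided by B. For even i the middle value v vanishes, and
    at i = 3 it is not positive. At i = n - 2 the explicit value gives t <= 1/2; for the other odd i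
    the sharp bound on t leaves 2/(n - 2), enough for 2v.\<close>
  have "t + 2 * v \<le> 1"
  proof -
    have "even i \<or> i = 3 \<or> (i = n - 2 \<and> odd i) \<or> (odd i \<and> 5 \<le> i \<and> i + 3 \<le> n)"
      using i r by presburger
    then consider "even i" | "i = 3" | "i = n - 2" "odd i" | "odd i" "5 \<le> i" "i + 3 \<le> n"
      by blast
    then show ?thesis
    proof cases
      case 1
      then have "v = 0" unfolding v_def using i r by (intro kap_middle_eq_0) auto
      moreover have "t \<le> 1" using t1 by simp
      ultimately show ?thesis by simp
    next
      case 2
      have "v = ((2 * real r - 2 * real r)\<^sup>2 - 2 * real r) / (2 * real r * (2 * real r - 1))"
        using kap_at_2[of r "2 * r"] 2 r n by (simp add: v_def)
      also have "\<dots> \<le> 0" using r n by (simp add: divide_le_0_iff)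
      finally have "v \<le> 0" .
      then show ?thesis using t1 by (simp add: abs_le_iff)
    next
      case 3
      have "kap n k i = - kap n k 2" using kap_reflect[of 2 n k] k 3 n by simp
      then have "t = (real n - d\<^sup>2) / (real n * (real n - 1)) * (real n / d)"
        using kap_at_2[of k n] k n by (simp add: t_def d_def power2_commute minus_divide_left)
      also have "\<dots> \<le> (real n - 1) / (real n * (real n - 1)) * (real n / d)"
        using d one_le_power[of d 2] by (intro mult_right_mono divide_right_mono) auto
      also have "\<dots> = 1 / d" using d by (simp add: field_simps)
      also have "\<dots> \<le> 1 / 2" using d by (intro divide_left_mono) auto
      finally have "t \<le> 1 / 2" .
      moreover have "1 / (real n - 2) \<le> 1 / 4" using d by (intro divide_left_mono) auto
      ultimately show ?thesis using v2 by linarith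
    next
      case 4
      have "t \<le> 1 - 2 / (real n - 2)"
      proof (cases "k = n")
        case True
        then have "kap n k i = -1" using kap_self_left[of i n] 4 i by simp
        then have "t \<le> 0" using d by (simp add: t_def)
        moreover have "2 / (real n - 2) \<le> 1" using d by simp
        ultimately show ?thesis by linarith
      next
        case False
        have "\<bar>kap n k i\<bar> \<le> (1 - 2 * real (n - k) / real n) * (1 - 2 / (real n - 2))"
          using abs_kap_le_sharp[of n "n - k" i] abs_kap_reflect_left[of k n i] 4 k n i False by auto
        also have "1 - 2 * real (n - k) / real n = d / real n"
          using k d by (simp add: d_def of_nat_diff field_simps)
        finally have "\<bar>kap n k i\<bar> * (real n / d) \<le> d / real n * (1 - 2 / (real n - 2)) * (real n / d)"
          using d by (intro mult_right_mono) auto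
        also have "\<dots> = 1 - 2 / (real n - 2)" using d by simp
        finally have "\<bar>kap n k i\<bar> * (real n / d) \<le> 1 - 2 / (real n - 2)" .
        moreover have "t \<le> \<bar>kap n k i\<bar> * (real n / d)"
          unfolding t_def using d by (intro mult_right_mono) auto
        ultimately show ?thesis by linarith
      qed
      moreover have "2 / (real n - 2) = 2 * (1 / (real n - 2))" by simp
      ultimately show ?thesis using v2 by linarith
    qed
  qed
  then have key: "1 + t \<le> 2 * (1 - v)" by simp
  have gap: "omega n r 1 - omega n r i = B * (2 * (1 - v))"
  proof -
    have "real ((2 * r) choose r) = 2 * B"
      using binomial_absorb_real(1)[of "2 * r" r] r n by (simp add: B_def algebra_simps)
    then show ?thesis using omega_gap_eq[of i n r] i r by (simp add: v_def)
  qed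
  show "real ((n - 2) choose r) * (1 + kap n k i * (real n / (2 * real k - real n)))
      \<le> omega n r 1 - omega n r i"
    unfolding gap using mult_left_mono[OF key, of B] by (simp add: B_def t_def d_def)
qed

text \<open>Algebra shared by both points for small r, with (N, K) = (n + 1, k + 1) for two indices
  and (n, k) for one. The mass X makes the left side at i = 2 exactly 2B.\<close>

lemma low_scale:
  fixes N K B :: real
  assumes "N > 1" "K > 0" "2 * K - N - 1 > 0" and X: "X = N * (N - 1) * B / ((2 * K - N - 1) * K)"
    and k2: "k2 = ((N - 2 * K)\<^sup>2 - N) / (N * (N - 1))"
  shows "X * (k2 + (2 * K / N - 1)) = 2 * B"
    "X * ((2 * K / N - 1) * (a - 1) - 1) = (N - 1) * B / (2 * K - N - 1) * (2 * (a - 1) - a * (N / K))"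
proof -
  define e where "e = 2 * K - N - 1"
  have e: "e > 0" using assms(3) by (simp add: e_def)
  have N0: "N \<noteq> 0" "N - 1 \<noteq> 0" using assms(1) by auto
  have "k2 + (2 * K / N - 1) = ((N - 2 * K)\<^sup>2 - N + (2 * K - N) * (N - 1)) / (N * (N - 1))"
    unfolding k2 using N0 by (simp add: add_divide_distrib diff_divide_distrib)
  also have "(N - 2 * K)\<^sup>2 - N + (2 * K - N) * (N - 1) = e * (2 * K)"
    by (simp add: e_def power2_eq_square algebra_simps)
  finally have "X * (k2 + (2 * K / N - 1)) = N * (N - 1) * B / (e * K) * (e * (2 * K) / (N * (N - 1)))"
    by (simp add: X e_def)
  also have "\<dots> = 2 * B" using N0 e assms(2) by simp
  finally show "X * (k2 + (2 * K / N - 1)) = 2 * B" .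
  have "N / K * ((2 * K / N - 1) * (a - 1) - 1) = 2 * (a - 1) - a * (N / K)"
    using N0 assms(2) by (simp add: field_simps)
  moreover have "X = (N - 1) * B / e * (N / K)" by (simp add: X e_def)
  ultimately show "X * ((2 * K / N - 1) * (a - 1) - 1) = (N - 1) * B / (2 * K - N - 1) * (2 * (a - 1) - a * (N / K))"
    unfolding e_def by (simp only: mult.assoc)
qed

text \<open>As k + 1 is even, reflection at length n + 1 identifies the values at n and 1, so the
  left side vanishes at i = n. The other constraints reduce to i = 2 by A.\<close>

lemma Lambda_bar_ge_low_even:
  assumes k: "odd k" "n < 2 * k" "k \<le> n" and n: "2 \<le> n" and B: "gap_ge n r B"
    and A: "\<And>i. 2 \<le> i \<Longrightarrow> i + 2 \<le> n + 1 \<Longrightarrow> kap (n + 1) (k + 1) i \<le> kap (n + 1) (k + 1) 2"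
  shows "ereal (real n * B / (2 * real k - real n)
      * (2 * (1 / \<alpha> - 1) - 1 / \<alpha> * ((real n + 1) / (real k + 1)))) \<le> Lambda_bar n \<alpha> r"
proof -
  define N where "N = real n + 1"
  define K where "K = real k + 1"
  define X where "X = N * (N - 1) * B / ((2 * K - N - 1) * K)"
  have e: "2 * K - N - 1 = 2 * real k - real n" by (simp add: K_def N_def)
  have pos: "N > 1" "K > 0" "2 * K - N - 1 > 0" using k n by (auto simp: K_def N_def)
  have B0: "0 \<le> B" using B by (simp add: gap_ge_def)
  have X0: "0 \<le> X" unfolding X_def using pos B0 by (intro divide_nonneg_pos mult_nonneg_nonneg mult_pos_pos) auto
  have k2: "kap (n + 1) (k + 1) 2 = ((N - 2 * K)\<^sup>2 - N) / (N * (N - 1))"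
    using kap_at_2[of "k + 1" "n + 1"] k n by (simp add: N_def K_def add.commute)
  note scale = low_scale[OF pos X_def k2]
  have NK: "real (n + 1) = N" "real (k + 1) = K" by (simp_all add: N_def K_def)
  have "ereal (X * ((2 * real (k + 1) / real (n + 1) - 1) * (1 / \<alpha> - 1) - 1)) \<le> Lambda_bar n \<alpha> r"
  proof (rule Lambda_bar_ge_double)
    fix i assume i: "2 \<le> i" "i \<le> n"
    show "X * (kap (n + 1) (k + 1) i + (2 * real (k + 1) / real (n + 1) - 1)) \<le> omega n r 1 - omega n r i"
    proof (cases "i = n")
      case True
      have "kap (n + 1) (k + 1) (n + 1 - 1) = kap (n + 1) (k + 1) 1"
        using kap_reflect[of 1 "n + 1" "k + 1"] k by simp
      then have "kap (n + 1) (k + 1) i + (2 * real (k + 1) / real (n + 1) - 1) = 0"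
        using kap_at_1[of "k + 1" "n + 1"] k True by simp
      then show ?thesis using omega_gap_nonneg[of i n r] i by simp
    next
      case False
      have "X * (kap (n + 1) (k + 1) i + (2 * real (k + 1) / real (n + 1) - 1))
          \<le> X * (kap (n + 1) (k + 1) 2 + (2 * real (k + 1) / real (n + 1) - 1))"
        using A[of i] i False X0 by (intro mult_left_mono) auto
      also have "\<dots> = 2 * B" unfolding NK by (rule scale(1))
      also have "\<dots> \<le> omega n r 1 - omega n r i" using B i False by (simp add: gap_ge_def)
      finally show ?thesis .
    qed
  qed (use k X0 in auto)
  then show ?thesis unfolding NK scale(2) e by (simp add: N_def K_def)
qed

text \<open>Domination by the value at 2 stops at i = n - 2, and \<open>F_set\<close> is what the
  last two constraints require: for even k only i = n matters and asks for r <= 2k - n - 1; for odd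
  k only i = n - 1 matters.\<close>

lemma Lambda_bar_ge_low_odd:
  assumes k: "k \<le> n" "n + 1 < 2 * k" and r: "odd r" "2 * r + 2 \<le> n" and kF: "k \<in> F_set n r"
    and A: "\<And>i. 2 \<le> i \<Longrightarrow> i + 2 \<le> n \<Longrightarrow> kap n k i \<le> kap n k 2"
  shows "ereal ((real n - 1) * real ((n - 2) choose (r - 1)) / (2 * real k - real n - 1)
      * (2 * (1 / \<alpha> - 1) - 1 / \<alpha> * (real n / real k))) \<le> Lambda_bar n \<alpha> r"
proof -
  define N where "N = real n"
  define K where "K = real k"
  define m where "m = n - 1"
  define B where "B = real ((n - 2) choose (r - 1))"
  define C where "C = real (m choose r)"
  define X where "X = N * (N - 1) * B / ((2 * K - N - 1) * K)"
  define e where "e = 2 * K - N - 1"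
  have r1: "1 \<le> r" using r by (cases r) auto
  have pos: "N > 1" "K > 0" "2 * K - N - 1 > 0" using k r by (auto simp: K_def N_def)
  have gap: "gap_ge n r B" unfolding B_def using r r1 by (intro gap_ge_low)
  have B0: "0 \<le> B" by (simp add: B_def)
  have C0: "0 \<le> C" by (simp add: C_def)
  have X0: "0 \<le> X" unfolding X_def using pos B0 by (intro divide_nonneg_pos mult_nonneg_nonneg mult_pos_pos) auto
  have m: "n = Suc m" "real m = N - 1" "r < m" using r by (auto simp: m_def N_def of_nat_diff)
  have BC: "(N - 1) * B = real r * C"
    using binomial_absorb_real(2)[of m r] m r1 by (simp add: B_def C_def)
  have k2: "kap n k 2 = ((N - 2 * K)\<^sup>2 - N) / (N * (N - 1))"
    using kap_at_2[of k n] k by (simp add: N_def K_def)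
  note scale = low_scale[OF pos X_def k2]
  have X_eq: "X = real r * C / e * (N / K)"
    unfolding X_def BC[symmetric] by (simp add: e_def)
  have "ereal (X * ((2 * real k / real n - 1) * (1 / \<alpha> - 1) - 1)) \<le> Lambda_bar n \<alpha> r"
  proof (rule Lambda_bar_ge_single)
    fix i assume i: "2 \<le> i" "i \<le> n"
    consider (mid) "i + 2 \<le> n" | (n1) "i = n - 1" | (n) "i = n" using i by linarith
    then show "X * (kap n k i + (2 * real k / real n - 1)) \<le> omega n r 1 - omega n r i"
    proof cases
      case mid
      have "X * (kap n k i + (2 * real k / real n - 1)) \<le> X * (kap n k 2 + (2 * real k / real n - 1))"
        using A[of i] i mid X0 by (intro mult_left_mono) auto
      also have "\<dots> = 2 * B" using scale(1) by (simp add: N_def K_def)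
      also have "\<dots> \<le> omega n r 1 - omega n r i" using gap i mid by (simp add: gap_ge_def)
      finally show ?thesis .
    next
      case n1
      have kap: "kap n k i = (-1) ^ k * (1 - 2 * K / N)"
        using kap_reflect[of 1 n k] kap_at_1[of k n] k n1 by (simp add: N_def K_def)
      show ?thesis
      proof (cases "even k")
        case True
        then have "kap n k i + (2 * real k / real n - 1) = 0" unfolding kap by (simp add: N_def K_def)
        then show ?thesis using omega_gap_nonneg[of i n r] i by simp
      next
        case False
        \<comment> \<open>The constraint at i = n - 1 amounts to c (e + 1) <= K e, that is c <= (K -
          c) e. The threshold in \<open>F_set\<close> gives K - c >= s and e >= 2s, and s is such
          that 2 s^2 >= c.\<close>
        define c where "c = (N - 1) * real r / (N - 1 - real r)"
        define s where "s = sqrt ((N + 1) * real r / (2 * (N - 1 - real r)))"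
        have mr: "N - 1 - real r > 0" using m by linarith
        have F: "K \<ge> max ((N + 1) / 2) c + s"
          using kF False by (auto simp: F_set_def K_def N_def c_def s_def)
        have s0: "0 \<le> s" unfolding s_def using mr pos by simp
        have s2: "s\<^sup>2 = (N + 1) * real r / (2 * (N - 1 - real r))"
          unfolding s_def using mr pos by (intro real_sqrt_pow2) auto
        have "c \<le> 2 * s\<^sup>2"
        proof -
          have "2 * s\<^sup>2 = (N + 1) * real r / (N - 1 - real r)" unfolding s2 using mr by (simp add: field_simps)
          then show ?thesis unfolding c_def using mr by (simp add: divide_right_mono mult_right_mono)
        qed
        also have "\<dots> = s * (2 * s)" by (simp add: power2_eq_square)
        also have "\<dots> \<le> (K - c) * e"
        proof (rule mult_mono)
          have "(N + 1) / 2 + s \<le> K" "c + s \<le> K"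
            using F max.cobounded1[of "(N + 1) / 2" c] max.cobounded2[of c "(N + 1) / 2"] by linarith+
          then show "s \<le> K - c" "2 * s \<le> e" by (simp_all add: e_def field_simps)
        qed (use F s0 in auto)
        finally have "c * (e + 1) \<le> K * e" by (simp add: algebra_simps)
        then have c: "c * (e + 1) / (K * e) \<le> 1" using pos by (simp add: e_def)
        have rc: "(N - 1) * real r = (N - 1 - real r) * c" using mr by (simp add: c_def)
        have "X * (kap n k i + (2 * real k / real n - 1)) = X * (2 * ((e + 1) / N))"
          unfolding kap using False pos by (simp add: N_def K_def e_def field_simps)
        also have "\<dots> = 2 * C * (real r * (e + 1) / (K * e))"
        proof -
          have "real r * C / e * (N / K) * (2 * (f / N)) = 2 * C * (real r * f / (K * e))" for f
            using pos by (simp add: mult_ac)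
          then show ?thesis unfolding X_eq .
        qed
        also have "real r * (e + 1) / (K * e) = (1 - real r / (N - 1)) * (c * (e + 1) / (K * e))"
        proof -
          have "1 - real r / (N - 1) = (N - 1 - real r) / (N - 1)" using pos by (simp add: field_simps)
          moreover have "real r = (N - 1 - real r) / (N - 1) * c" using rc pos by (simp add: field_simps)
          ultimately have "real r = (1 - real r / (N - 1)) * c" by simp
          from arg_cong[OF this, of "\<lambda>t. t * ((e + 1) / (K * e))"] show ?thesis by simp
        qed
        also have "2 * C * \<dots> \<le> 2 * C * ((1 - real r / (N - 1)) * 1)"
          using c C0 mr pos by (intro mult_left_mono) auto
        also have "\<dots> = omega n r 1 - omega n r i"
        proof -
          have v: "kap m r (m - 1) = - (1 - 2 * real r / (N - 1))"
            using kap_reflect[of 1 m r] kap_at_1[of r m] r m by simp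
          have "omega n r 1 - omega n r i = C * (1 - kap m r (m - 1))"
            using omega_gap_eq[of i n r] i r n1 m by (simp add: C_def)
          then show ?thesis unfolding v by simp
        qed
        finally show ?thesis .
      qed
    next
      case n
      have kap: "kap n k i = (-1) ^ k" using kap_at_top[of k n] k n by simp
      show ?thesis
      proof (cases "even k")
        case True
        have "real r \<le> e" using kF True by (auto simp: F_set_def e_def K_def N_def)
        then have "real r / e \<le> 1" using pos by (simp add: e_def)
        have "X * (kap n k i + (2 * real k / real n - 1)) = 2 * C * (real r / e)"
          unfolding kap X_eq using True pos by (simp add: N_def K_def)
        also have "\<dots> \<le> 2 * C * 1" using \<open>real r / e \<le> 1\<close> C0 by (intro mult_left_mono) auto
        also have "\<dots> = omega n r 1 - omega n r i"
          using omega_gap_eq[of i n r] i r n m kap_at_top[of r m] by (simp add: C_def)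
        finally show ?thesis .
      next
        case False
        have "2 * real k / real n - 1 \<le> 1" using k pos by (simp add: divide_le_eq N_def)
        then have "X * (kap n k i + (2 * real k / real n - 1)) \<le> 0"
          unfolding kap using X0 False by (simp add: mult_le_0_iff)
        then show ?thesis using omega_gap_nonneg[of i n r] i by simp
      qed
    qed
  qed (use k X0 in auto)
  then show ?thesis using scale(2)[of "1 / \<alpha>"] by (simp add: N_def K_def B_def)
qed

section \<open>The four clauses for large n\<close>

lemma gbinomial_minus_2: "2 \<le> n \<Longrightarrow> (real n - 2) gchoose j = real ((n - 2) choose j)"
  by (simp add: binomial_gbinomial of_nat_diff)

lemma eventually_psi_tilde_le_Lambda_bar:
  fixes \<delta> :: real
  assumes \<delta>: "0 < \<delta>"
  shows "\<forall>\<^sub>F n in sequentially. \<forall>\<alpha>. \<forall>r\<in>{1..n}. psi_tilde \<delta> n \<alpha> r \<le> Lambda_bar n \<alpha> r"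
proof -
  have A: "\<forall>\<^sub>F n in sequentially. \<forall>k i. k \<le> n \<longrightarrow> \<delta> * real n \<le> 2 * real k - real n \<longrightarrow> 2 \<le> i \<longrightarrow> i + 2 \<le> n
    \<longrightarrow> \<bar>kap n k i\<bar> \<le> kap n k 2"
    by (rule eventually_abs_kap_le_kap_2[OF \<delta>])
  \<comment> \<open>The point on two indices lives at length n + 1. The index range gives 2k - n >=
    2\<delta>n, twice what domination needs, which leaves room for this shift.\<close>
  have A': "\<forall>\<^sub>F n in sequentially. \<forall>k i. k \<le> Suc n \<longrightarrow> \<delta> * real (Suc n) \<le> 2 * real k - real (Suc n) \<longrightarrow> 2 \<le> i
    \<longrightarrow> i + 2 \<le> Suc n \<longrightarrow> \<bar>kap (Suc n) k i\<bar> \<le> kap (Suc n) k 2"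
    using A by (subst eventually_sequentially_Suc)
  have lin: "\<forall>\<^sub>F n in sequentially. 2 \<le> \<delta> * real n"
    using \<delta> by (rule eventually_le_linear)
  show ?thesis
    using A A' lin eventually_ge_at_top[of 7]
  proof eventually_elim
    case (elim n)
    show ?case
    proof (intro allI ballI)
      fix \<alpha> r assume r: "r \<in> {1..n}"
      have n: "7 \<le> n" "2 \<le> n" using elim by auto
      have low: "n + 1 < 2 * k" "\<delta> * real n \<le> 2 * real k - real n" "\<delta> * real (Suc n) \<le> 2 * real (Suc k) - real (Suc n)"
        if k: "(1 / 2 + \<delta>) * real n \<le> real k" "k \<le> n" for k
      proof -
        have *: "2 * (\<delta> * real n) \<le> 2 * real k - real n" using k by (simp add: algebra_simps)
        show "n + 1 < 2 * k" "\<delta> * real n \<le> 2 * real k - real n" using * elim by linarith+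
        have "\<delta> * 1 \<le> \<delta> * real n" using \<delta> n by (intro mult_left_mono) auto
        then show "\<delta> * real (Suc n) \<le> 2 * real (Suc k) - real (Suc n)" 
          using * by (simp add: distrib_left)
      qed
      have high: "n + 2 \<le> 2 * k" if "real n / 2 + 1 \<le> real k" for k using that by linarith
      show "psi_tilde \<delta> n \<alpha> r \<le> Lambda_bar n \<alpha> r"
      proof (cases "real r \<le> real n / 2 - 1")
        case True
        then have r2: "2 * r + 2 \<le> n" by linarith
        show ?thesis
        proof (cases "even r")
          case ev: True
          show ?thesis
            unfolding psi_tilde_def if_P[OF True] if_P[OF ev] gbinomial_minus_2[OF n(2)]
          proof (rule SUP_least, clarify)
            fix k assume k: "odd k" "(1 / 2 + \<delta>) * real n \<le> real k" "k \<le> n"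
            have "kap (n + 1) (k + 1) i \<le> kap (n + 1) (k + 1) 2" if "2 \<le> i" "i + 2 \<le> n + 1" for i
            proof -
              have "\<bar>kap (Suc n) (Suc k) i\<bar> \<le> kap (Suc n) (Suc k) 2"
                using elim(2) low(3)[OF k(2,3)] k that by auto
              then show ?thesis by simp
            qed
            then show "ereal (real n * real ((n - 2) choose (r - 1)) / (2 * real k - real n)
                * (2 * (1 / \<alpha> - 1) - 1 / \<alpha> * ((real n + 1) / (real k + 1)))) \<le> Lambda_bar n \<alpha> r"
              using r r2 k n low(1)[OF k(2,3)] by (intro Lambda_bar_ge_low_even gap_ge_low) auto
          qed
        next
          case od: False
          show ?thesis
            unfolding psi_tilde_def if_P[OF True] if_not_P[OF od] gbinomial_minus_2[OF n(2)]
          proof (rule SUP_least, clarify)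
            fix k assume k: "k \<in> F_set n r" "(1 / 2 + \<delta>) * real n \<le> real k" "k \<le> n"
            have "kap n k i \<le> kap n k 2" if "2 \<le> i" "i + 2 \<le> n" for i
            proof -
              have "\<bar>kap n k i\<bar> \<le> kap n k 2"
                using elim(1) low(2)[OF k(2,3)] k that by auto
              then show ?thesis by simp
            qed
            then show "ereal ((real n - 1) * real ((n - 2) choose (r - 1)) / (2 * real k - real n - 1)
                * (2 * (1 / \<alpha> - 1) - 1 / \<alpha> * (real n / real k))) \<le> Lambda_bar n \<alpha> r"
              using r2 k od low(1)[OF k(2,3)] by (intro Lambda_bar_ge_low_odd) auto
          qed
        qed
      next
        case False
        then have r2: "n \<le> 2 * r + 1" by linarith
        show ?thesis
        proof (cases "even r")
          case ev: True
          show ?thesis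
            unfolding psi_tilde_def if_not_P[OF False] if_P[OF ev] gbinomial_minus_2[OF n(2)]
            by (rule SUP_least, clarify, rule Lambda_bar_ge_single_of_gap)
              (use high gap_ge_high_Suc[OF r2] in auto)
        next
          case od: False
          show ?thesis
            unfolding psi_tilde_def if_not_P[OF False] if_not_P[OF od] gbinomial_minus_2[OF n(2)]
          proof (rule SUP_least, clarify)
            fix k assume k: "odd k" "real n / 2 + 1 \<le> real k" "k \<le> n"
            show "ereal (real k * real ((n - 2) choose r) / (2 * real k - real n)
                * (2 * (1 / \<alpha> - 1) - 1 / \<alpha> * (real n / real k))) \<le> Lambda_bar n \<alpha> r"
            proof (cases "n = 2 * r + 1")
              case True
              then show ?thesis using k high[OF k(2)] od n by (intro Lambda_bar_ge_single_middle) auto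
            next
              case False
              then show ?thesis using k high[OF k(2)] r2
                by (intro Lambda_bar_ge_single_of_gap gap_ge_high) auto
            qed
          qed
        qed
      qed
    qed
  qed
qed

section \<open>Asymptotic lower bounds\<close>

lemma phi_eq:
  assumes "0 < \<alpha>" "\<alpha> < 1 / 4"
  shows "phi \<alpha> = 2 * (1 / sqrt \<alpha> - 1)\<^sup>2"
proof -
  have s: "sqrt \<alpha> > 0" "\<alpha> = (sqrt \<alpha>)\<^sup>2" using assms by auto
  have "1 / sqrt \<alpha> - 1 = (1 - sqrt \<alpha>) / sqrt \<alpha>" using s(1) by (simp add: field_simps)
  then show ?thesis using assms by (simp add: phi_def power_divide)
qed

lemma phi_diff_eq:
  fixes a y :: real
  assumes "0 < y"
  shows "2 * (a - 1)\<^sup>2 - 2 / (1 + y) * (a\<^sup>2 - 1 - 1 / y) = 2 * ((a - 1) * y - 1)\<^sup>2 / (y * (1 + y))"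
proof -
  have "1 + y \<noteq> 0" "y \<noteq> 0" using assms by auto
  then have "2 / (1 + y) * (a\<^sup>2 - 1 - 1 / y) = 2 * ((a\<^sup>2 - 1) * y - 1) / (y * (1 + y))"
    by (simp add: field_simps)
  moreover have "2 * (a - 1)\<^sup>2 = 2 * (a - 1)\<^sup>2 * (y * (1 + y)) / (y * (1 + y))"
    using \<open>1 + y \<noteq> 0\<close> \<open>y \<noteq> 0\<close> by simp
  ultimately have "2 * (a - 1)\<^sup>2 - 2 / (1 + y) * (a\<^sup>2 - 1 - 1 / y)
      = (2 * (a - 1)\<^sup>2 * (y * (1 + y)) - 2 * ((a\<^sup>2 - 1) * y - 1)) / (y * (1 + y))"
    by (simp only: diff_divide_distrib)
  also have "2 * (a - 1)\<^sup>2 * (y * (1 + y)) - 2 * ((a\<^sup>2 - 1) * y - 1) = 2 * ((a - 1) * y - 1)\<^sup>2"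
    by (simp add: power2_eq_square algebra_simps)
  finally show ?thesis .
qed

text \<open>For \<alpha> < 1/4, \<open>phi_hat\<close> is the function f of the overview at y = 2
  \<open>eta_hat\<close> - 1. So it suffices to reach \<open>phi\<close> for r of either
  parity.\<close>

lemma phi_hat_le_phi:
  assumes "0 < \<alpha>"
  shows "phi_hat \<alpha> \<beta> \<le> phi \<alpha>"
proof (cases "\<alpha> < 1 / 4")
  case True
  define a where "a = 1 / sqrt \<alpha>"
  define y where "y = 2 * eta_hat \<alpha> \<beta> - 1"
  have a2: "1 / \<alpha> = a\<^sup>2" using assms by (simp add: a_def power_divide)
  have "sqrt \<alpha> < 1" using True real_sqrt_less_mono[of \<alpha> 1] by simp
  moreover have "0 < sqrt \<alpha>" using assms by simp
  ultimately have "1 / 2 < 1 / (2 * (1 - sqrt \<alpha>))" by (simp add: field_simps)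
  then have y: "0 < y" unfolding y_def eta_hat_def by linarith
  have eta: "eta_hat \<alpha> \<beta> = (1 + y) / 2" by (simp add: y_def)
  have "1 / (\<alpha> * eta_hat \<alpha> \<beta>) = a\<^sup>2 / ((1 + y) / 2)"
    unfolding a2[symmetric] eta by simp
  then have "phi_hat \<alpha> \<beta> = 1 / y * (2 * (a\<^sup>2 - 1) - a\<^sup>2 / ((1 + y) / 2))"
    unfolding phi_hat_def if_P[OF True] a2[symmetric] y_def[symmetric] by simp
  also have "\<dots> = 2 / (1 + y) * (a\<^sup>2 - 1 - 1 / y)" using y by (simp add: field_simps)
  also have "\<dots> \<le> 2 * (a - 1)\<^sup>2"
  proof -
    have "0 \<le> 2 * ((a - 1) * y - 1)\<^sup>2 / (y * (1 + y))" using y by simp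
    then show ?thesis unfolding phi_diff_eq[OF y, symmetric] by linarith
  qed
  finally show ?thesis using phi_eq[OF assms True] by (simp add: a_def)
qed (simp add: phi_hat_def phi_def)

lemma phi_le:
  assumes "0 < \<alpha>"
  shows "phi \<alpha> \<le> 2 / \<alpha>"
proof (cases "\<alpha> < 1 / 4")
  case True
  have "sqrt \<alpha> \<le> 1" using True real_sqrt_le_mono[of \<alpha> 1] by simp
  then have "(1 - sqrt \<alpha>)\<^sup>2 \<le> 1" using assms by (intro power_le_one) auto
  then have "2 * (1 - sqrt \<alpha>)\<^sup>2 / \<alpha> \<le> 2 / \<alpha>" using assms by (intro divide_right_mono) auto
  then show ?thesis using True by (simp add: phi_def)
next
  case False
  have "1 / \<alpha> \<le> 2 / \<alpha>" using assms by (intro divide_right_mono) auto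
  then show ?thesis using False by (simp add: phi_def)
qed

text \<open>For \<alpha> < 1/4 the function f is maximal at t = 1/b with b = 1/sqrt \<alpha> - 1.
  Rounding to an odd k moves y by at most 4/n and loses at most 64 b^3/n^2, which is at most
  512/sqrt n because b <= 2 sqrt n. For larger \<alpha> the largest odd k <= n serves.\<close>

lemma Lambda_bar_ge_phi:
  assumes n: "256 \<le> n" and B: "gap_ge n r B" and \<alpha>: "0 < \<alpha>" and a: "1 / sqrt \<alpha> - 1 \<le> 2 * sqrt (real n)"
  shows "ereal (B * (phi \<alpha> - 512 / sqrt (real n))) \<le> Lambda_bar n \<alpha> r"
proof -
  define w where "w = sqrt (real n)"
  have w: "16 \<le> w" unfolding w_def using n by (intro real_le_rsqrt) auto
  have w2: "real n = w * w" by (simp add: w_def)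
  have B0: "0 \<le> B" using B by (simp add: gap_ge_def)
  have reduce: "ereal (B * (phi \<alpha> - 512 / w)) \<le> Lambda_bar n \<alpha> r"
    if "ereal (B * v) \<le> Lambda_bar n \<alpha> r" "phi \<alpha> - 512 / w \<le> v" for v
    using mult_left_mono[OF that(2) B0] that(1) by (meson ereal_less_eq(3) order_trans)
  show ?thesis
  proof (cases "\<alpha> < 1 / 4")
    case False
    define k where "k = (if odd n then n else n - 1)"
    have k: "odd k" "n \<le> k + 1" "k \<le> n" "n + 1 < 2 * k" using n by (auto simp: k_def)
    have u: "1 \<le> (real n - 1) / (real k - 1)" using k n by (simp add: le_divide_eq)
    have "ereal (B * 1 * (1 / \<alpha> - 1 - real n / (2 * real k - real n))) \<le> Lambda_bar n \<alpha> r"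
      using k B u by (intro Lambda_bar_ge_scaled_tail) auto
    then have "ereal (B * (1 / \<alpha> - 1 - real n / (2 * real k - real n))) \<le> Lambda_bar n \<alpha> r" by simp
    moreover have "phi \<alpha> - 512 / w \<le> 1 / \<alpha> - 1 - real n / (2 * real k - real n)"
    proof -
      have "16 * w \<le> real n" unfolding w2 using w by (intro mult_right_mono) auto
      then have nw: "w \<le> real n - 2" using w by linarith
      have "real n / (2 * real k - real n) \<le> real n / (real n - 2)"
        using k n by (intro divide_left_mono) auto
      also have "\<dots> = 1 + 2 / (real n - 2)" using n by (simp add: field_simps)
      also have "2 / (real n - 2) \<le> 512 / w" using nw w by (intro frac_le) auto
      finally show ?thesis using False by (simp add: phi_def)
    qed
    ultimately show ?thesis unfolding w_def[symmetric] by (rule reduce)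
  next
    case True
    define b where "b = 1 / sqrt \<alpha> - 1"
    define t where "t = 1 / b"
    have b1: "1 < b"
    proof -
      have "sqrt \<alpha> < sqrt (1 / 4)" using True by (rule real_sqrt_less_mono)
      then have "sqrt \<alpha> < 1 / 2" by (simp add: real_sqrt_divide)
      then have "2 < 1 / sqrt \<alpha>" using \<alpha> by (simp add: field_simps)
      then show ?thesis by (simp add: b_def)
    qed
    have b2: "b \<le> 2 * w" using a by (simp add: b_def w_def)
    have t: "0 < t" "t < 1" using b1 by (auto simp: t_def)
    \<comment> \<open>Rounding lowers 2k by less than 4, so this keeps y >= t/2 and k above the
      middle.\<close>
    have nt: "8 \<le> real n * t"
    proof -
      have "8 * b \<le> 8 * (2 * w)" using b2 by simp
      also have "\<dots> \<le> w * w" using mult_right_mono[of 16 w w] w by simp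
      finally show ?thesis using b1 w2 by (simp add: t_def le_divide_eq)
    qed
    define z where "z = nat \<lfloor>real n * (1 + t) / 2\<rfloor>"
    define k where "k = (if odd z then z else z - 1)"
    have nt1: "real n * t < real n" using t n by simp
    have z: "real z \<le> real n * (1 + t) / 2" "real n * (1 + t) / 2 < real z + 1"
      unfolding z_def using t by (auto simp: of_nat_nat)  linarith+
    have z1: "1 \<le> z" using z nt n by (simp add: distrib_left)
    have k: "odd k" "real z - 1 \<le> real k" "real k \<le> real z" using z1 by (auto simp: k_def of_nat_diff)
    have kk: "2 * real k \<le> real n + real n * t" "real n + real n * t < 2 * real k + 4"
      using z k by (auto simp: distrib_left)
    have kn: "k \<le> n" "n + 1 < 2 * k" using kk nt nt1 by linarith+
    define y where "y = (2 * real k - real n) / real n"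
    have n0: "real n > 0" using n by simp
    have yn: "real n * y = 2 * real k - real n" using n0 by (simp add: y_def)
    have y_le: "y \<le> t"
    proof -
      have "real n * y \<le> real n * t" using kk yn by linarith
      then show ?thesis using n0 by simp
    qed
    have y_ge: "t - y \<le> 4 / real n"
    proof -
      have "real n * (t - y) \<le> 4" using kk yn by (simp add: right_diff_distrib)
      then show ?thesis using n0 by (simp add: field_simps)
    qed
    have y_half: "t / 2 \<le> y"
    proof -
      have "real n * (t / 2) \<le> real n * y" using kk yn nt by simp
      then show ?thesis using n0 by simp
    qed
    then have y0: "0 < y" using t by linarith
    have "ereal (B * (2 / (1 + y)) * (1 / \<alpha> - 1 - real n / (2 * real k - real n))) \<le> Lambda_bar n \<alpha> r"
    proof (rule Lambda_bar_ge_scaled_tail)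
      have "1 + y = 2 * real k / real n" using n0 by (simp add: y_def field_simps)
      then have "2 / (1 + y) = real n / real k" by simp
      also have "\<dots> \<le> (real n - 1) / (real k - 1)" using kn n by (simp add: field_simps)
      finally show "2 / (1 + y) \<le> (real n - 1) / (real k - 1)" .
    qed (use k kn B y0 in auto)
    moreover have "real n / (2 * real k - real n) = 1 / y" by (simp add: y_def)
    moreover have a2: "1 / \<alpha> = (b + 1)\<^sup>2" using \<alpha> by (simp add: b_def power_divide)
    ultimately have "ereal (B * (2 / (1 + y) * ((b + 1)\<^sup>2 - 1 - 1 / y))) \<le> Lambda_bar n \<alpha> r"
      by (simp add: mult.assoc)
    moreover have "phi \<alpha> - 512 / w \<le> 2 / (1 + y) * ((b + 1)\<^sup>2 - 1 - 1 / y)"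
    proof -
      have "phi \<alpha> - 2 / (1 + y) * ((b + 1)\<^sup>2 - 1 - 1 / y) = 2 * (b * y - 1)\<^sup>2 / (y * (1 + y))"
        using phi_diff_eq[OF y0, of "b + 1"] phi_eq[OF \<alpha> True] by (simp add: b_def)
      also have "\<dots> \<le> 2 * (b * y - 1)\<^sup>2 / (t / 2)"
      proof (rule divide_left_mono)
        have "t / 2 * 1 \<le> y * (1 + y)" using y_half y0 t by (intro mult_mono) auto
        then show "t / 2 \<le> y * (1 + y)" by simp
        show "0 < y * (1 + y) * (t / 2)" using y0 t by simp
      qed simp
      also have "\<dots> = 4 * b * (b * y - 1)\<^sup>2" using b1 by (simp add: t_def)
      also have "(b * y - 1)\<^sup>2 = b\<^sup>2 * (t - y)\<^sup>2"
      proof -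
        have "b * y - 1 = b * (y - t)" using b1 by (simp add: t_def field_simps)
        then show ?thesis by (simp add: power_mult_distrib power2_commute)
      qed
      also have "4 * b * (b\<^sup>2 * (t - y)\<^sup>2) \<le> 4 * b * (b\<^sup>2 * (4 / real n)\<^sup>2)"
        using y_ge y_le b1 by (intro mult_left_mono power_mono) auto
      also have "\<dots> = 64 * b ^ 3 / (real n)\<^sup>2" by (simp add: power2_eq_square power3_eq_cube)
      also have "\<dots> \<le> 64 * (2 * w) ^ 3 / (real n)\<^sup>2"
        using b1 b2 by (intro divide_right_mono mult_left_mono power_mono) auto
      also have "\<dots> = 512 / w" unfolding w2 using w by (simp add: power2_eq_square power3_eq_cube)
      finally show ?thesis by linarith
    qed
    ultimately show ?thesis unfolding w_def[symmetric] by (rule reduce)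
  qed
qed

text \<open>The first h terms are at most 2G each. Beyond them the weight (2j - n)/(2h) is at least
  1, and the weighted sum is nG/(2h). The choice h of about sqrt n / 2 balances the two
  parts.\<close>

lemma sum_binomial_tail_le_sqrt:
  assumes r: "n \<le> 2 * r" "r < n"
  shows "(\<Sum>j=Suc r..n. real (n choose j)) \<le> (2 * sqrt (real n) + 2) * real ((n - 1) choose r)"
proof -
  define G where "G = real ((n - 1) choose r)"
  define h where "h = nat \<lceil>sqrt (real n) / 2\<rceil>"
  have n0: "real n > 0" using r by simp
  have w: "sqrt (real n) > 0" using n0 by simp
  have h: "sqrt (real n) \<le> 2 * real h" "2 * real h \<le> sqrt (real n) + 2"
    unfolding h_def using w by linarith+
  have h0: "real h > 0" using h w by linarith
  have absorb: "real n * G = real (Suc r) * real (n choose Suc r)"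
    using binomial_absorb_real(2)[of n "Suc r"] r by (simp add: G_def)
  have first: "real (n choose j) \<le> 2 * G" if "Suc r \<le> j" "j \<le> n" for j
  proof -
    have "real (n choose j) \<le> real (n choose Suc r)"
      using that r by (intro of_nat_mono binomial_antimono) auto
    also have "real (Suc r) * real (n choose Suc r) \<le> real (Suc r) * (2 * G)"
    proof -
      have "real n * G \<le> real (Suc r) * 2 * G" using r by (intro mult_right_mono) (auto simp: G_def)
      then show ?thesis unfolding absorb[symmetric] by (simp only: mult.assoc)
    qed
    then have "real (n choose Suc r) \<le> 2 * G"
      by (simp only: mult_le_cancel_left_pos of_nat_0_less_iff zero_less_Suc)
    finally show ?thesis .
  qed
  have "(\<Sum>j=Suc r..n. real (n choose j)) \<le>
      (\<Sum>j=Suc r..n. (if j \<le> r + h then 2 * G else 0) + 1 / (2 * real h) * ((2 * real j - real n) * real (n choose j)))"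
  proof (rule sum_mono)
    fix j assume "j \<in> {Suc r..n}"
    then have j: "Suc r \<le> j" "j \<le> n" by auto
    show "real (n choose j) \<le> (if j \<le> r + h then 2 * G else 0)
        + 1 / (2 * real h) * ((2 * real j - real n) * real (n choose j))"
    proof (cases "j \<le> r + h")
      case True
      have "0 \<le> 1 / (2 * real h) * ((2 * real j - real n) * real (n choose j))"
        using j r by (intro mult_nonneg_nonneg) auto
      then show ?thesis using first[OF j] True by simp
    next
      case False
      have "1 \<le> 1 / (2 * real h) * (2 * real j - real n)" using False r h0 by (simp add: field_simps)
      then have "1 * real (n choose j) \<le> 1 / (2 * real h) * (2 * real j - real n) * real (n choose j)"
        by (intro mult_right_mono) auto
      then show ?thesis using False by simp
    qed
  qed
  also have "\<dots> = (\<Sum>j=Suc r..n. if j \<le> r + h then 2 * G else 0) + 1 / (2 * real h) * (real n * G)"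
    unfolding sum.distrib sum_distrib_left[symmetric] absorb
    using sum_binomial_weighted[of "Suc r" n] r by (simp del: of_nat_Suc)
  also have "(\<Sum>j=Suc r..n. if j \<le> r + h then 2 * G else 0) \<le> real h * (2 * G)"
  proof -
    have "(\<Sum>j=Suc r..n. if j \<le> r + h then 2 * G else 0) = (\<Sum>j\<in>{Suc r..n} \<inter> {j. j \<le> r + h}. 2 * G)"
      by (simp add: sum.If_cases)
    also have "\<dots> = real (card ({Suc r..n} \<inter> {j. j \<le> r + h})) * (2 * G)" by simp
    also have "\<dots> \<le> real h * (2 * G)"
    proof (rule mult_right_mono)
      have "card ({Suc r..n} \<inter> {j. j \<le> r + h}) \<le> card {Suc r..r + h}" by (intro card_mono) auto
      then show "real (card ({Suc r..n} \<inter> {j. j \<le> r + h})) \<le> real h" by simp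
    qed (simp add: G_def)
    finally show ?thesis .
  qed
  also have "1 / (2 * real h) * (real n * G) \<le> sqrt (real n) * G"
  proof -
    have "real n / (2 * real h) \<le> sqrt (real n)"
    proof -
      have "real n = sqrt (real n) * sqrt (real n)" by simp
      also have "\<dots> \<le> sqrt (real n) * (2 * real h)" using h w by (intro mult_left_mono) auto
      finally show ?thesis using h0 by (simp add: divide_le_eq)
    qed
    then have "real n / (2 * real h) * G \<le> sqrt (real n) * G" by (intro mult_right_mono) (auto simp: G_def)
    then show ?thesis by simp
  qed
  also have "real h * (2 * G) + sqrt (real n) * G \<le> (2 * sqrt (real n) + 2) * G"
  proof -
    have "2 * real h * G \<le> (sqrt (real n) + 2) * G" using h by (intro mult_right_mono) (auto simp: G_def)
    then show ?thesis by (simp add: algebra_simps)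
  qed
  finally show ?thesis by (simp add: G_def)
qed

text \<open>The indicator of \<open>{r<..n}\<close> makes every constraint tight; for small \<open>\<alpha>\<close> it is good enough.\<close>

lemma Lambda_bar_ge_phi_small:
  assumes r: "n \<le> 2 * r" "r < n" and \<alpha>: "0 < \<alpha>" and n: "2 \<le> n"
    and a: "sqrt (real n) + 1 \<le> 1 / sqrt \<alpha> - 1"
  shows "ereal (real ((n - 2) choose r) * phi \<alpha>) \<le> Lambda_bar n \<alpha> r"
proof -
  define b where "b = 1 / sqrt \<alpha> - 1"
  define C where "C = real ((n - 1) choose r)"
  have b: "sqrt (real n) + 1 \<le> b" using a by (simp add: b_def)
  have a2: "1 / \<alpha> = (b + 1)\<^sup>2" using \<alpha> by (simp add: b_def power_divide)
  have \<alpha>4: "\<alpha> < 1 / 4"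
  proof -
    have "0 < sqrt (real n)" using n by simp
    then have "2 < b + 1" using b by linarith
    then have "2\<^sup>2 < (b + 1)\<^sup>2" by (intro power_strict_mono) auto
    then have "4 < 1 / \<alpha>" using a2 by simp
    then show ?thesis using \<alpha> by (simp add: field_simps)
  qed
  have "2 * real ((n - 2) choose r) \<le> C"
  proof -
    have "real (n - 1) * real ((n - 1 - 1) choose r) = (real (n - 1) - real r) * C"
      unfolding C_def using r n by (intro binomial_absorb_real(1)) auto
    also have "\<dots> \<le> real (n - 1) / 2 * C" using r by (intro mult_right_mono) (auto simp: C_def)
    finally have "real (n - 1) * real ((n - 2) choose r) \<le> real (n - 1) * (C / 2)"
      by (simp add: numeral_2_eq_2)
    then show ?thesis using n by simp
  qed
  then have "2 * real ((n - 2) choose r) * b\<^sup>2 \<le> C * b\<^sup>2" by (intro mult_right_mono) auto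
  \<comment> \<open>With 1/\<alpha> = (b + 1)^2 this is equivalent, up to the factor C, to b >= sqrt
    n + 1.\<close>
  also have "\<dots> \<le> C * (1 / \<alpha> - 1 - (2 * sqrt (real n) + 2))"
    using b unfolding a2 by (intro mult_left_mono) (auto simp: C_def power2_eq_square algebra_simps)
  also have "\<dots> \<le> 1 * (C * (1 / \<alpha> - 1) - (\<Sum>j=Suc r..n. real (n choose j)))"
    using sum_binomial_tail_le_sqrt[OF r] by (simp add: C_def algebra_simps)
  finally have "real ((n - 2) choose r) * phi \<alpha> \<le> 1 * (C * (1 / \<alpha> - 1) - (\<Sum>j=Suc r..n. real (n choose j)))"
    unfolding phi_eq[OF \<alpha> \<alpha>4] by (simp add: b_def)
  moreover have "ereal (1 * (C * (1 / \<alpha> - 1) - (\<Sum>j=Suc r..n. real (n choose j)))) \<le> Lambda_bar n \<alpha> r"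
    unfolding C_def using r by (intro Lambda_bar_ge_tail) auto
  ultimately show ?thesis by (meson ereal_less_eq(3) order_trans)
qed

lemma ereal_nonpos_le_Lambda_bar: "v \<le> 0 \<Longrightarrow> ereal v \<le> Lambda_bar n \<alpha> r"
  using Lambda_bar_nonneg[of n \<alpha> r] by (metis ereal_less_eq(3) order_trans zero_ereal_def)

text \<open>The two constructions overlap and together cover every \<alpha> > 0, so the error
  depends on n only; hence the last two error sequences do not depend on \<delta>. For r >= n the
  coefficient is zero.\<close>

lemma Lambda_bar_ge_phi_high:
  assumes n: "256 \<le> n" and r: "n \<le> 2 * r" and \<alpha>: "0 < \<alpha>"
  shows "ereal (real ((n - 2) choose r) * (phi \<alpha> - 512 / sqrt (real n))) \<le> Lambda_bar n \<alpha> r"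
proof (cases "1 / sqrt \<alpha> - 1 \<le> 2 * sqrt (real n)")
  case True
  then show ?thesis using n \<alpha> gap_ge_high[OF r] by (intro Lambda_bar_ge_phi)
next
  case False
  show ?thesis
  proof (cases "r < n")
    case True
    have "1 \<le> sqrt (real n)" using n by simp
    then have "sqrt (real n) + 1 \<le> 1 / sqrt \<alpha> - 1" using False by linarith
    then have "ereal (real ((n - 2) choose r) * phi \<alpha>) \<le> Lambda_bar n \<alpha> r"
      using True n r \<alpha> by (intro Lambda_bar_ge_phi_small) auto
    moreover have "real ((n - 2) choose r) * (phi \<alpha> - 512 / sqrt (real n)) \<le> real ((n - 2) choose r) * phi \<alpha>"
      by (intro mult_left_mono) auto
    ultimately show ?thesis by (meson ereal_less_eq(3) order_trans)
  next
    case rn: False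
    then have z: "(n - 2) choose r = 0" using n by (intro binomial_eq_0) auto
    show ?thesis unfolding z by (intro ereal_nonpos_le_Lambda_bar) simp
  qed
qed

section \<open>Error sequences valid for all n\<close>

lemma tendsto_const_over_sqrt: "(\<lambda>n. c / sqrt (real n)) \<longlonglongrightarrow> 0"
  by (intro tendsto_divide_0[OF tendsto_const] filterlim_at_top_imp_at_infinity
      filterlim_compose[OF sqrt_at_top filterlim_real_sequentially])

text \<open>For small n an error term of -2^(n + 1) thus makes the claimed bound
  nonpositive.\<close>

lemma phi_le_power:
  assumes "1 \<le> M"
  shows "phi (real M / 2 ^ n) \<le> 2 ^ (n + 1)"
proof -
  have "phi (real M / 2 ^ n) \<le> 2 / (real M / 2 ^ n)" using assms by (intro phi_le) auto
  also have "\<dots> = 2 ^ (n + 1) / real M" by simp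
  also have "\<dots> \<le> 2 ^ (n + 1) / 1" using assms by (intro divide_left_mono) auto
  finally show ?thesis by simp
qed

text \<open>Once \<delta>n >= 1, the hypothesis on r gives 2r + 2 <= n, and \<alpha> >= \<delta>
  gives 1/sqrt \<alpha> <= sqrt n. The parameter p stands for \<open>phi\<close> or
  \<open>phi_hat\<close>.\<close>

lemma Lambda_bar_ge_kappa_low:
  assumes n: "2 \<le> n" and r: "1 \<le> r" "real r \<le> real n * (1 / 2 - \<delta>)" and \<delta>: "0 < \<delta>"
    and M: "1 \<le> M" and \<alpha>: "\<alpha> = real M / 2 ^ n" "\<delta> \<le> \<alpha>"
    and e: "e = (if 256 \<le> n \<and> 1 \<le> \<delta> * real n then - (512 / sqrt (real n)) else - (2 ^ (n + 1)))"
    and p: "p \<le> phi \<alpha>"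
  shows "ereal (((real n - 2) gchoose (r - 1)) * (p + e)) \<le> Lambda_bar n \<alpha> r"
proof -
  define B where "B = real ((n - 2) choose (r - 1))"
  have \<alpha>0: "0 < \<alpha>" using \<alpha> \<delta> by linarith
  have "ereal (B * (phi \<alpha> + e)) \<le> Lambda_bar n \<alpha> r"
  proof (cases "256 \<le> n \<and> 1 \<le> \<delta> * real n")
    case True
    have "2 * r + 2 \<le> n"
    proof -
      have "2 * real r + 2 * (\<delta> * real n) \<le> real n" using r by (simp add: algebra_simps)
      then show ?thesis using True by linarith
    qed
    then have B: "gap_ge n r B" unfolding B_def using r by (intro gap_ge_low)
    have "1 / sqrt \<alpha> \<le> sqrt (real n)"
    proof -
      have "1 \<le> \<alpha> * real n" using True mult_right_mono[OF \<alpha>(2), of "real n"] by linarith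
      then have "1 \<le> sqrt \<alpha> * sqrt (real n)" by (simp flip: real_sqrt_mult)
      then show ?thesis using \<alpha>0 by (simp add: field_simps)
    qed
    moreover have "0 \<le> sqrt (real n)" by simp
    ultimately have "1 / sqrt \<alpha> - 1 \<le> 2 * sqrt (real n)" by linarith
    from Lambda_bar_ge_phi[OF _ B \<alpha>0 this] show ?thesis using True e by simp
  next
    case False
    have "phi \<alpha> + e \<le> 0" using phi_le_power[OF M, of n] False e \<alpha> by (auto split: if_splits)
    then show ?thesis by (intro ereal_nonpos_le_Lambda_bar) (simp add: B_def mult_nonneg_nonpos)
  qed
  moreover have "B * (p + e) \<le> B * (phi \<alpha> + e)" using p by (intro mult_left_mono) (auto simp: B_def)
  ultimately show ?thesis unfolding gbinomial_minus_2[OF n] B_def by (meson ereal_less_eq(3) order_trans)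
qed

text \<open>When the bracket is positive, the coefficient at r + 1 may be replaced by the larger one
  at r; otherwise nonnegativity of the optimum suffices.\<close>

lemma Lambda_bar_ge_kappa_high:
  assumes n: "2 \<le> n" and r: "n \<le> 2 * r" and M: "1 \<le> M" and \<alpha>: "\<alpha> = real M / 2 ^ n"
    and e: "e = (if 256 \<le> n then - (512 / sqrt (real n)) else - (2 ^ (n + 1)))"
    and j: "j = r \<or> j = r + 1"
  shows "ereal (((real n - 2) gchoose j) * (phi \<alpha> + e)) \<le> Lambda_bar n \<alpha> r"
proof -
  define B where "B = real ((n - 2) choose j)"
  have \<alpha>0: "0 < \<alpha>" using \<alpha> M by simp
  have "ereal (B * (phi \<alpha> + e)) \<le> Lambda_bar n \<alpha> r"
  proof (cases "0 < phi \<alpha> + e")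
    case True
    then have n256: "256 \<le> n" using phi_le_power[OF M, of n] e \<alpha> by (auto split: if_splits)
    have "B \<le> real ((n - 2) choose r)"
    proof -
      have "real (Suc r) * real ((n - 2) choose Suc r) \<le> real (Suc r) * real ((n - 2) choose r)"
        unfolding Suc_times_binomial_real using r by (intro mult_right_mono) auto
      then have "real ((n - 2) choose Suc r) \<le> real ((n - 2) choose r)" by simp
      then show ?thesis using j by (auto simp: B_def)
    qed
    then have "B * (phi \<alpha> + e) \<le> real ((n - 2) choose r) * (phi \<alpha> + e)"
      using True by (intro mult_right_mono) auto
    then show ?thesis using Lambda_bar_ge_phi_high[OF n256 r \<alpha>0] n256 e
      by simp (meson ereal_less_eq(3) order_trans)
  next
    case False
    then show ?thesis by (intro ereal_nonpos_le_Lambda_bar) (simp add: B_def mult_nonneg_nonpos)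
  qed
  then show ?thesis unfolding gbinomial_minus_2[OF n] B_def .
qed

theorem theorem13:
  shows "(\<forall>\<delta>::real. \<delta> > 0 \<longrightarrow>
           (\<forall>\<^sub>F n in sequentially. \<forall>M\<in>{1..(2::nat) ^ n}. \<forall>r\<in>{1..n}.
              Lambda_bar n (real M / 2 ^ n) r \<ge> max (psi_tilde \<delta> n (real M / 2 ^ n) r) 0)) \<and>
         (\<exists>\<epsilon>3 \<epsilon>4 :: nat \<Rightarrow> real. \<epsilon>3 \<longlonglongrightarrow> 0 \<and> \<epsilon>4 \<longlonglongrightarrow> 0 \<and>
           (\<forall>\<delta>::real. \<delta> > 0 \<longrightarrow>
             (\<exists>\<epsilon>1 \<epsilon>2 :: nat \<Rightarrow> real. \<epsilon>1 \<longlonglongrightarrow> 0 \<and> \<epsilon>2 \<longlonglongrightarrow> 0 \<and>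
               (\<forall>n. \<forall>M\<in>{1..(2::nat) ^ n}. \<forall>r\<in>{1..n}.
                  real M / 2 ^ n \<in> {\<delta>..1/2} \<longrightarrow>
                  real r / real n \<in> {0<..1/2 - \<delta>} \<union> {1/2..1} \<longrightarrow>
                  Lambda_bar n (real M / 2 ^ n) r
                    \<ge> ereal (kappa \<delta> \<epsilon>1 \<epsilon>2 \<epsilon>3 \<epsilon>4 n (real M / 2 ^ n) r)))))"
proof (intro conjI allI impI)
  fix \<delta> :: real assume "\<delta> > 0"
  from eventually_psi_tilde_le_Lambda_bar[OF this]
  show "\<forall>\<^sub>F n in sequentially. \<forall>M\<in>{1..(2::nat) ^ n}. \<forall>r\<in>{1..n}.
      Lambda_bar n (real M / 2 ^ n) r \<ge> max (psi_tilde \<delta> n (real M / 2 ^ n) r) 0"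
    by eventually_elim (use Lambda_bar_nonneg in auto)
next
  \<comment> \<open>For \<open>n = r = 1\<close> the coefficient \<open>(n - 2) gchoose r\<close> is \<open>-1\<close>, so the error term must not be negative there.\<close>
  define \<epsilon> :: "nat \<Rightarrow> real" where
    "\<epsilon> n = (if n = 1 then 0 else if 256 \<le> n then - (512 / sqrt (real n)) else - (2 ^ (n + 1)))" for n
  define \<epsilon>' :: "real \<Rightarrow> nat \<Rightarrow> real" where
    "\<epsilon>' \<delta> n = (if 256 \<le> n \<and> 1 \<le> \<delta> * real n then - (512 / sqrt (real n)) else - (2 ^ (n + 1)))" for \<delta> n
  have lim: "(\<lambda>n. - (512 / sqrt (real n))) \<longlonglongrightarrow> 0"
    using tendsto_minus[OF tendsto_const_over_sqrt[of 512]] by simp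
  have \<epsilon>: "\<epsilon> \<longlonglongrightarrow> 0"
    by (rule Lim_transform_eventually[OF lim], rule eventually_mono[OF eventually_ge_at_top[of 256]])
      (simp add: \<epsilon>_def)
  have \<epsilon>': "\<epsilon>' \<delta> \<longlonglongrightarrow> 0" if "0 < \<delta>" for \<delta>
    by (rule Lim_transform_eventually[OF lim],
        rule eventually_mono[OF eventually_conj[OF eventually_ge_at_top[of 256] eventually_le_linear[OF that, of 1]]])
      (simp add: \<epsilon>'_def)
  have main: "ereal (kappa \<delta> (\<epsilon>' \<delta>) (\<epsilon>' \<delta>) \<epsilon> \<epsilon> n (real M / 2 ^ n) r) \<le> Lambda_bar n (real M / 2 ^ n) r"
    if \<delta>: "0 < \<delta>" and M: "M \<in> {1..(2::nat) ^ n}" and r: "r \<in> {1..n}"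
      and \<alpha>: "real M / 2 ^ n \<in> {\<delta>..1/2}" and \<beta>: "real r / real n \<in> {0<..1/2 - \<delta>} \<union> {1/2..1}"
    for \<delta> n M r
  proof -
    have n0: "real n > 0" using r by simp
    show ?thesis
    proof (cases "real r \<le> real n * (1/2 - \<delta>)")
      case True
      have n2: "2 \<le> n"
      proof (rule ccontr)
        assume "\<not> 2 \<le> n"
        then have "n = 1" "r = 1" using r by auto
        then show False using True \<delta> by simp
      qed
      note low = Lambda_bar_ge_kappa_low[OF n2 _ True \<delta> _ refl _ \<epsilon>'_def[of \<delta> n]]
      have "1 \<le> r" "1 \<le> M" "\<delta> \<le> real M / 2 ^ n" using r M \<alpha> by auto
      note low = low[OF this]
      show ?thesis
        unfolding kappa_def if_P[OF True]
        using low[OF order_refl] low[OF phi_hat_le_phi] M by (cases "even r") auto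
    next
      case False
      have "1 / 2 \<le> real r / real n"
      proof -
        have "\<not> real r / real n \<le> 1 / 2 - \<delta>" using False n0 by (simp add: divide_le_eq mult.commute)
        then show ?thesis using \<beta> by auto
      qed
      then have r2: "n \<le> 2 * r" using n0 by (simp add: field_simps)
      have M1: "1 \<le> M" using M by simp
      show ?thesis
      proof (cases "n = 1")
        case True
        then have "r = 1" using r by simp
        have "phi (real M / 2 ^ n) = 0"
        proof -
          have "M = 1" using \<alpha> M1 True by simp
          then show ?thesis using True by (simp add: phi_def)
        qed
        then have "kappa \<delta> (\<epsilon>' \<delta>) (\<epsilon>' \<delta>) \<epsilon> \<epsilon> n (real M / 2 ^ n) r = 0"
          unfolding kappa_def if_not_P[OF False] using True \<open>r = 1\<close> by (simp add: \<epsilon>_def)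
        then show ?thesis using ereal_nonpos_le_Lambda_bar by simp
      next
        case n1: False
        then have n2: "2 \<le> n" using r by simp
        have e: "\<epsilon> n = (if 256 \<le> n then - (512 / sqrt (real n)) else - (2 ^ (n + 1)))"
          using n1 by (simp add: \<epsilon>_def)
        note high = Lambda_bar_ge_kappa_high[OF n2 r2 M1 refl e]
        show ?thesis
          unfolding kappa_def if_not_P[OF False] using high[of r] high[of "r + 1"] by simp
      qed
    qed
  qed
  show "\<exists>\<epsilon>3 \<epsilon>4 :: nat \<Rightarrow> real. \<epsilon>3 \<longlonglongrightarrow> 0 \<and> \<epsilon>4 \<longlonglongrightarrow> 0 \<and>
           (\<forall>\<delta>::real. \<delta> > 0 \<longrightarrow>
             (\<exists>\<epsilon>1 \<epsilon>2 :: nat \<Rightarrow> real. \<epsilon>1 \<longlonglongrightarrow> 0 \<and> \<epsilon>2 \<longlonglongrightarrow> 0 \<and>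
               (\<forall>n. \<forall>M\<in>{1..(2::nat) ^ n}. \<forall>r\<in>{1..n}.
                  real M / 2 ^ n \<in> {\<delta>..1/2} \<longrightarrow>
                  real r / real n \<in> {0<..1/2 - \<delta>} \<union> {1/2..1} \<longrightarrow>
                  Lambda_bar n (real M / 2 ^ n) r
                    \<ge> ereal (kappa \<delta> \<epsilon>1 \<epsilon>2 \<epsilon>3 \<epsilon>4 n (real M / 2 ^ n) r))))"
    using \<epsilon> \<epsilon>' main
    by (intro exI[of _ \<epsilon>] conjI allI impI exI[of _ "\<epsilon>' _"] ballI) blast+
qed

end
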